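(* For every path $P_{n+1}$ ($n\ge1$) and every cycle $C_{n+1}$ ($n\ge2$), and every maximal tubing $\mathcal{T}^\circ$ on it, both the compatibility fan $\mathcal{C}(G,\mathcal{T}^\circ)$ and the dual compatibility fan $\mathcal{C}^*(G,\mathcal{T}^\circ)$ are polytopal, i.e. each is the normal fan of a polytope.
   Context: For a finite simple graph $G$ with vertex set $V$: a tube is a nonempty subset of $V$ inducing a connected subgraph, proper if it is not a connected component. Two tubes are compatible if nested or disjoint and non-adjacent (their union is not a tube). A tubing is a set of pairwise compatible proper tubes. The compatibility degree is $\delta(T\,\|\,T')=-1$ if $T=T'$; the number of vertices of $T'\setminus T$ adjacent to $T$ if $T\not\subseteq T'$; $0$ otherwise. For a maximal tubing $\mathcal{T}^\circ=\{T^\circ_1,\dots,T^\circ_n\}$, $\mathcal{C}(G,\mathcal{T}^\circ)$ (resp. $\mathcal{C}^*(G,\mathcal{T}^\circ)$) is the collection of cones in $\mathbb{R}^n$ generated, for each tubing $\mathcal{T}$, by the vectors $(\delta(T^\circ_i\,\|\,T))_{i}$ (resp. $(\delta(T\,\|\,T^\circ_i))_i$), $T\in\mathcal{T}$; these are complete simplicial fans. *)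

theory Defs
  imports "Graph_Theory.Pair_Digraph" "Graph_Theory.Digraph_Component" "HOL-Analysis.Analysis"
begin

text \<open>
  A finite simple graph is a \<^locale>\<open>pair_graph\<close>: a finite, symmetric, loop-free set of vertex
  pairs. Both orientations of every edge are present. The names \<open>connected\<close> and \<open>compatible\<close> exist
  in several of the imported theories; graph connectedness is always written qualified below.
\<close>

definition path_graph :: "nat \<Rightarrow> nat pair_pre_digraph" where
  "path_graph m =
     \<lparr>pverts = {..<m}, parcs = {(u, v). u < m \<and> v < m \<and> (v = u + 1 \<or> u = v + 1)}\<rparr>"

text \<open>A simple graph (the cycle \<open>C\<^sub>m\<close>) only for \<open>m \<ge> 3\<close>.\<close>

definition cycle_graph :: "nat \<Rightarrow> nat pair_pre_digraph" where
  "cycle_graph m =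
     \<lparr>pverts = {..<m},
      parcs = {(u, v). u < m \<and> v < m \<and> (v = (u + 1) mod m \<or> u = (v + 1) mod m)}\<rparr>"

lemma pair_graph_path_graph: "pair_graph (path_graph m)"
proof
  show "finite (parcs (path_graph m))"
    by (rule finite_subset[of _ "{..<m} \<times> {..<m}"]) (auto simp: path_graph_def)
qed (auto simp: path_graph_def symmetric_def sym_def)

lemma pair_graph_cycle_graph:
  assumes "m \<ge> 3" shows "pair_graph (cycle_graph m)"
proof
  show "finite (parcs (cycle_graph m))"
    by (rule finite_subset[of _ "{..<m} \<times> {..<m}"]) (auto simp: cycle_graph_def)
next
  fix e assume "e \<in> parcs (cycle_graph m)"
  then show "fst e \<noteq> snd e"
    using assms by (auto simp: cycle_graph_def mod_Suc split: if_splits)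
qed (auto simp: cycle_graph_def symmetric_def sym_def)


section \<open>Tubes and tubings\<close>

text \<open>\<^const>\<open>Digraph_Component.connected\<close> excludes the graph without vertices, so tubes are nonempty.\<close>

definition tube :: "'v pair_pre_digraph \<Rightarrow> 'v set \<Rightarrow> bool" where
  "tube G T \<longleftrightarrow> T \<subseteq> pverts G \<and> Digraph_Component.connected (with_proj G \<restriction> T)"

text \<open>
  \<open>sccs_verts\<close> are the vertex sets of the strong components; as \<open>G\<close> is symmetric, these
  are the connected components.
\<close>

definition proper_tube :: "'v pair_pre_digraph \<Rightarrow> 'v set \<Rightarrow> bool" where
  "proper_tube G T \<longleftrightarrow> tube G T \<and> T \<notin> pre_digraph.sccs_verts (with_proj G)"

definition tubes_compatible :: "'v pair_pre_digraph \<Rightarrow> 'v set \<Rightarrow> 'v set \<Rightarrow> bool" where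
  "tubes_compatible G T T' \<longleftrightarrow>
     T \<subseteq> T' \<or> T' \<subseteq> T \<or> (T \<inter> T' = {} \<and> \<not> tube G (T \<union> T'))"

definition tubing :: "'v pair_pre_digraph \<Rightarrow> 'v set set \<Rightarrow> bool" where
  "tubing G \<T> \<longleftrightarrow>
     (\<forall>T\<in>\<T>. proper_tube G T) \<and> (\<forall>T\<in>\<T>. \<forall>T'\<in>\<T>. tubes_compatible G T T')"

definition maximal_tubing :: "'v pair_pre_digraph \<Rightarrow> 'v set set \<Rightarrow> bool" where
  "maximal_tubing G \<T> \<longleftrightarrow> tubing G \<T> \<and> (\<forall>\<T>'. tubing G \<T>' \<and> \<T> \<subseteq> \<T>' \<longrightarrow> \<T>' = \<T>)"


section \<open>Compatibility fans\<close>

definition compatibility_degree :: "'v pair_pre_digraph \<Rightarrow> 'v set \<Rightarrow> 'v set \<Rightarrow> int" where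
  "compatibility_degree G T T' =
     (if T = T' then - 1
      else if \<not> T \<subseteq> T' then int (card {v \<in> T' - T. \<exists>u\<in>T. (u, v) \<in> parcs G})
      else 0)"

text \<open>
  The initial tubing is given by an enumeration \<open>T0\<close> of its tubes, so the fans live in the
  Euclidean space \<open>real ^ 'i\<close> whose coordinates are indexed by these tubes. The empty tubing
  contributes the cone \<open>convex_cone hull {} = {0}\<close>.
\<close>

definition compatibility_vector ::
    "'v pair_pre_digraph \<Rightarrow> ('i::finite \<Rightarrow> 'v set) \<Rightarrow> 'v set \<Rightarrow> real ^ 'i" where
  "compatibility_vector G T0 T = (\<chi> i. of_int (compatibility_degree G (T0 i) T))"

definition dual_compatibility_vector ::
    "'v pair_pre_digraph \<Rightarrow> ('i::finite \<Rightarrow> 'v set) \<Rightarrow> 'v set \<Rightarrow> real ^ 'i" where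
  "dual_compatibility_vector G T0 T = (\<chi> i. of_int (compatibility_degree G T (T0 i)))"

definition compatibility_fan ::
    "'v pair_pre_digraph \<Rightarrow> ('i::finite \<Rightarrow> 'v set) \<Rightarrow> (real ^ 'i) set set" where
  "compatibility_fan G T0 =
     {convex_cone hull (compatibility_vector G T0 ` \<T>) |\<T>. tubing G \<T>}"

definition dual_compatibility_fan ::
    "'v pair_pre_digraph \<Rightarrow> ('i::finite \<Rightarrow> 'v set) \<Rightarrow> (real ^ 'i) set set" where
  "dual_compatibility_fan G T0 =
     {convex_cone hull (dual_compatibility_vector G T0 ` \<T>) |\<T>. tubing G \<T>}"


section \<open>Normal fans\<close>

text \<open>
  Outer normal cones. Inner normal cones would give the same notion of polytopality, by
  passing from \<open>P\<close> to \<open>- P\<close>.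
\<close>

definition normal_cone :: "'a::euclidean_space set \<Rightarrow> 'a set \<Rightarrow> 'a set" where
  "normal_cone P F = {c. \<forall>x\<in>F. \<forall>y\<in>P. c \<bullet> y \<le> c \<bullet> x}"

definition normal_fan :: "'a::euclidean_space set \<Rightarrow> 'a set set" where
  "normal_fan P = {normal_cone P F |F. F face_of P \<and> F \<noteq> {}}"

definition polytopal :: "'a::euclidean_space set set \<Rightarrow> bool" where
  "polytopal \<F> \<longleftrightarrow> (\<exists>P. polytope P \<and> P \<noteq> {} \<and> \<F> = normal_fan P)"

end

theory Submission
  imports Defs
begin

text \<open>
  Identify the tubes of \<open>P\<^sub>m\<close> with the diagonals of an \<open>(m + 2)\<close>-gon, and those of
  \<open>C\<^sub>m\<close> with the orbits of diagonals of a \<open>2m\<close>-gon under the half turn. Up to positive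
  factors the compatibility degree is then a crossing number, so after rescaling coordinates or
  generators both fans are generated by vectors \<open>v\<^sub>T\<close> that record the crossings of \<open>T\<close> with the
  initial tubing (with a minus sign at the initial tubes themselves).

  If the diagonals \<open>pr\<close> and \<open>qs\<close> cross, some positive combination of their two vectors equals the
  sum of the crossing vectors of two sides of the quadrilateral \<open>pqrs\<close>. Give a diagonal of length
  \<open>l\<close> in the \<open>N\<close>-gon the height \<open>l (N - l)\<close>, and every initial diagonal a very large height;
  then this substitution strictly decreases the total height. Hence the inequalities of
  \<open>P = {y. \<forall>T. v\<^sub>T \<bullet> y \<le> h\<^sub>T}\<close> that are tight at a point of \<open>P\<close> always form a tubing, so the
  normal cones of \<open>P\<close> belong to the fan. Conversely the initial tubing is a vertex of \<open>P\<close>, the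
  edges of \<open>P\<close> realize flips, and flips connect all maximal tubings, so every cone occurs.
\<close>

section \<open>Fans of strictly convex height functions\<close>

text \<open>Away from the two diagonals themselves, \<open>crossing\<close> obeys a tropical Ptolemy
  rule: at each chord the diagonals of a quadrilateral together count the larger of the sums over
  its two pairs of opposite sides. The obstacle is that one vector identity needs the same pair to
  win at all initial chords at once. If neither pair does, two noncrossing initial chords favour
  different pairs, so they meet in a corner; then the diagonal through that corner has to be counted
  twice, and the sides to take are the two at the opposite corner. If that diagonal is itself
  initial, its entry -1 forces the coefficient back to 1, and the heights \<open>l (N - l)\<close>
  alone might increase. The value \<open>2 N^2 + 1\<close>, larger than the heights of any two sides
  together, absorbs this case. Flips are never constructed combinatorially: the tube that replaces
  another is the next facet met along an edge of the polytope, and the bound on the size of tubings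
  makes the vertex found there simple.\<close>

locale convex_heights =
  fixes K :: "'k set" and C :: "'k \<Rightarrow> 'k \<Rightarrow> bool"
    and v :: "'k \<Rightarrow> 'a::euclidean_space" and h :: "'k \<Rightarrow> real"
  assumes finite_K: "finite K"
    and straighten: "\<And>T U. T \<in> K \<Longrightarrow> U \<in> K \<Longrightarrow> \<not> C T U \<Longrightarrow>
      \<exists>\<alpha> \<beta> a. 0 \<le> \<alpha> \<and> 0 \<le> \<beta> \<and> (\<forall>S\<in>K. 0 \<le> a S) \<and>
        \<alpha> *\<^sub>R v T + \<beta> *\<^sub>R v U = (\<Sum>S\<in>K. a S *\<^sub>R v S) \<and>
        (\<Sum>S\<in>K. a S * h S) < \<alpha> * h T + \<beta> * h U"
    and bounded_halfspaces: "bounded {y. \<forall>T\<in>K. v T \<bullet> y \<le> h T}"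
begin

section \<open>The polytope cut out by the heights, and its normal cones\<close>

definition compat_set :: "'k set \<Rightarrow> bool" where
  "compat_set \<T> \<longleftrightarrow> \<T> \<subseteq> K \<and> (\<forall>T\<in>\<T>. \<forall>U\<in>\<T>. C T U)"

definition P :: "'a set" where
  "P = {y. \<forall>T\<in>K. v T \<bullet> y \<le> h T}"

definition active :: "'a \<Rightarrow> 'k set" where
  "active y = {T \<in> K. v T \<bullet> y = h T}"

lemma finite_active: "finite (active y)"
  using finite_K by (simp add: active_def)

text \<open>Pairing the straightening relation of two incompatible active constraints with
  \<open>y\<close> turns the left side into \<open>\<alpha> * h T + \<beta> * h U\<close>, while
  feasibility of \<open>y\<close> bounds the right side by the smaller sum of heights.\<close>

lemma active_compat_set:
  assumes "y \<in> P" shows "compat_set (active y)"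
  unfolding compat_set_def
proof (intro conjI ballI)
  show "active y \<subseteq> K" by (auto simp: active_def)
  fix T U assume TU: "T \<in> active y" "U \<in> active y"
  show "C T U"
  proof (rule ccontr)
    assume "\<not> C T U"
    then obtain \<alpha> \<beta> a where *: "\<forall>S\<in>K. 0 \<le> a S"
        "\<alpha> *\<^sub>R v T + \<beta> *\<^sub>R v U = (\<Sum>S\<in>K. a S *\<^sub>R v S)"
        "(\<Sum>S\<in>K. a S * h S) < \<alpha> * h T + \<beta> * h U"
      using TU straighten[of T U] by (auto simp: active_def)
    have "\<alpha> * h T + \<beta> * h U = (\<alpha> *\<^sub>R v T + \<beta> *\<^sub>R v U) \<bullet> y"
      using TU by (simp add: active_def inner_add_left)
    also have "\<dots> = (\<Sum>S\<in>K. a S * (v S \<bullet> y))"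
      by (simp add: *(2) inner_sum_left)
    also have "\<dots> \<le> (\<Sum>S\<in>K. a S * h S)"
      using *(1) \<open>y \<in> P\<close> by (intro sum_mono mult_left_mono) (auto simp: P_def)
    finally show False using *(3) by simp
  qed
qed

lemma polyhedron_P: "polyhedron P"
proof -
  have "P = \<Inter> ((\<lambda>T. {y. v T \<bullet> y \<le> h T}) ` K)" by (auto simp: P_def)
  then show ?thesis using finite_K
    by (auto intro!: polyhedron_Inter polyhedron_halfspace_le)
qed

lemma polytope_P: "polytope P"
  using polyhedron_P bounded_halfspaces by (simp add: polytope_eq_bounded_polyhedron P_def)

lemma convex_P: "convex P"
  by (simp add: polyhedron_imp_convex polyhedron_P)

text \<open>Used twice: with the direction of a Farkas argument, and with an edge direction that
  leaves a single facet.\<close>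

lemma small_move:
  assumes y: "y \<in> P" and d: "\<And>T. T \<in> active y \<Longrightarrow> v T \<bullet> d \<le> 0"
  obtains e where "e > 0" "y + e *\<^sub>R d \<in> P"
    "active (y + e *\<^sub>R d) = {T \<in> active y. v T \<bullet> d = 0}"
proof -
  \<comment> \<open>Half of the step at which an inactive constraint would become tight, so that it
    stays strict; the \<open>1\<close> covers the case that no constraint limits the step.\<close>
  define E where "E = insert 1 ((\<lambda>T. (h T - v T \<bullet> y) / (2 * (v T \<bullet> d))) ` {T \<in> K - active y. v T \<bullet> d > 0})"
  have fE: "finite E" using finite_K by (simp add: E_def)
  have slack: "v T \<bullet> y < h T" if "T \<in> K - active y" for T
    using that y by (auto simp: active_def P_def less_le)
  have pos: "x > 0" if "x \<in> E" for x
    using that slack by (auto simp: E_def intro!: divide_pos_pos)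
  define e where "e = Min E"
  have e0: "e > 0" unfolding e_def by (rule pos, rule Min_in[OF fE]) (simp add: E_def)
  have strict: "v T \<bullet> (y + e *\<^sub>R d) < h T" if T: "T \<in> K - active y" for T
  proof (cases "v T \<bullet> d > 0")
    case True
    have "e \<le> (h T - v T \<bullet> y) / (2 * (v T \<bullet> d))"
      unfolding e_def using fE True T by (intro Min_le) (auto simp: E_def)
    then have "2 * (e * (v T \<bullet> d)) \<le> h T - v T \<bullet> y"
      using True by (simp add: field_simps)
    moreover have "0 < e * (v T \<bullet> d)" using e0 True by simp
    ultimately show ?thesis by (simp add: inner_add_right)
  next
    case False
    then have "e * (v T \<bullet> d) \<le> 0" using e0 by (simp add: mult_nonneg_nonpos)
    then show ?thesis using slack[OF T] by (simp add: inner_add_right)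
  qed
  have act: "v T \<bullet> (y + e *\<^sub>R d) = h T + e * (v T \<bullet> d)" if "T \<in> active y" for T
    using that by (simp add: active_def inner_add_right)
  have "y + e *\<^sub>R d \<in> P"
    unfolding P_def
  proof (intro CollectI ballI)
    fix T assume "T \<in> K"
    show "v T \<bullet> (y + e *\<^sub>R d) \<le> h T"
    proof (cases "T \<in> active y")
      case True
      then have "e * (v T \<bullet> d) \<le> 0" using e0 d by (simp add: mult_nonneg_nonpos)
      then show ?thesis using act[OF True] by simp
    qed (use strict[of T] \<open>T \<in> K\<close> in auto)
  qed
  moreover have "active (y + e *\<^sub>R d) = {T \<in> active y. v T \<bullet> d = 0}"
  proof (rule set_eqI)
    fix T
    show "T \<in> active (y + e *\<^sub>R d) \<longleftrightarrow> T \<in> {T \<in> active y. v T \<bullet> d = 0}"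
    proof (cases "T \<in> active y")
      case True
      have "T \<in> active (y + e *\<^sub>R d) \<longleftrightarrow> v T \<bullet> (y + e *\<^sub>R d) = h T"
        using True by (simp add: active_def)
      also have "\<dots> \<longleftrightarrow> v T \<bullet> d = 0" using act[OF True] e0 by simp
      finally show ?thesis using True by simp
    next
      case False
      then have "T \<notin> active (y + e *\<^sub>R d)" using strict[of T] unfolding active_def by force
      then show ?thesis using False by blast
    qed
  qed
  ultimately show thesis by (rule that[OF e0])
qed

text \<open>Farkas: a hyperplane separating \<open>c\<close> from the finitely generated cone has a
  normal \<open>a\<close> that is nonnegative on the cone, so \<open>- a\<close> is a feasible
  direction at \<open>y\<close>, and it raises the value of \<open>c\<close>.\<close>

lemma normal_cone_point:
  assumes y: "y \<in> P" and c: "\<And>z. z \<in> P \<Longrightarrow> c \<bullet> z \<le> c \<bullet> y"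
  shows "c \<in> convex_cone hull (v ` active y)"
proof (rule ccontr)
  let ?H = "convex_cone hull (v ` active y)"
  assume "c \<notin> ?H"
  moreover have "closed ?H" using finite_active by (simp add: closed_convex_cone_hull)
  ultimately obtain a b where ab: "a \<bullet> c < b" "\<And>x. x \<in> ?H \<Longrightarrow> a \<bullet> x > b"
    using separating_hyperplane_closed_point[of ?H c] convex_convex_cone_hull by blast
  have b0: "b < 0" using ab(2)[OF convex_cone_hull_contains_0] by simp
  have nonneg: "a \<bullet> x \<ge> 0" if "x \<in> ?H" for x
  proof (rule ccontr)
    assume neg: "\<not> a \<bullet> x \<ge> 0"
    \<comment> \<open>The pairing of this multiple with \<open>a\<close> is exactly
      \<open>b\<close>, while the separation is strict.\<close>
    then have "(b / (a \<bullet> x)) *\<^sub>R x \<in> ?H"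
      using that b0 by (intro convex_cone_hull_mul) (auto simp: divide_nonpos_neg)
    from ab(2)[OF this] neg show False by simp
  qed
  have "v T \<bullet> (- a) \<le> 0" if "T \<in> active y" for T
  proof -
    have "v T \<in> ?H" using that by (intro hull_inc) auto
    then show ?thesis using nonneg[of "v T"] by (simp add: inner_commute)
  qed
  then obtain e where e: "e > 0" "y + e *\<^sub>R (- a) \<in> P"
    using small_move[OF y, of "- a"] by blast
  have "e * (a \<bullet> c) < 0" using ab(1) b0 e(1) by (simp add: mult_pos_neg)
  with c[OF e(2)] show False by (simp add: inner_diff_right inner_commute)
qed

text \<open>The face is represented by one of its points \<open>y\<close>, at which the active
  constraints are just those tight on all of \<open>F\<close>; both claims then follow from the
  statements about points.\<close>

lemma normal_cone_face:
  assumes F: "F face_of P" "F \<noteq> {}"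
  shows "normal_cone P F = convex_cone hull (v ` {T \<in> K. \<forall>x\<in>F. v T \<bullet> x = h T})"
    (is "_ = convex_cone hull (v ` ?A)")
    and "compat_set {T \<in> K. \<forall>x\<in>F. v T \<bullet> x = h T}"
proof -
  have FP: "F \<subseteq> P" using F face_of_imp_subset by blast
  have cF: "convex F" using F face_of_imp_convex by blast
  have "\<exists>y\<in>F. \<forall>T\<in>B. v T \<bullet> y < h T" if "finite B" "B \<subseteq> K - ?A" for B
    using that
  proof (induction B rule: finite_induct)
    case empty
    then show ?case using F by auto
  next
    case (insert T B)
    then obtain y where y: "y \<in> F" "\<forall>T\<in>B. v T \<bullet> y < h T" by auto
    obtain x where x: "x \<in> F" "v T \<bullet> x \<noteq> h T" and "T \<in> K" using insert.prems by auto
    have le: "v S \<bullet> z \<le> h S" if "z \<in> F" "S \<in> K" for S z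
      using that FP by (auto simp: P_def)
    \<comment> \<open>The midpoint keeps every strict inequality of \<open>y\<close> and inherits
      the one of \<open>x\<close>.\<close>
    define z where "z = (1/2) *\<^sub>R x + (1/2) *\<^sub>R y"
    have "z \<in> F" unfolding z_def using cF x(1) y(1) by (intro convexD) auto
    moreover have "v T \<bullet> x < h T" using x le[OF x(1) \<open>T \<in> K\<close>] by auto
    then have "v T \<bullet> z < h T"
      using le[OF y(1) \<open>T \<in> K\<close>] by (simp add: z_def inner_add_right)
    moreover have "v S \<bullet> z < h S" if "S \<in> B" for S
    proof -
      have "v S \<bullet> x \<le> h S" using that insert.prems x(1) le by auto
      moreover have "v S \<bullet> y < h S" using that y by auto
      ultimately show ?thesis by (simp add: z_def inner_add_right)
    qed
    ultimately show ?case by auto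
  qed
  from this[of "K - ?A"] obtain y where y: "y \<in> F" "\<forall>T\<in>K - ?A. v T \<bullet> y < h T"
    using finite_K by auto
  have act: "active y = ?A" proof
    show "active y \<subseteq> ?A" using y(2) by (force simp: active_def)
    show "?A \<subseteq> active y" using y(1) by (auto simp: active_def)
  qed
  have yP: "y \<in> P" using y FP by auto
  show "compat_set ?A" using active_compat_set[OF yP] act by simp
  show "normal_cone P F = convex_cone hull (v ` ?A)"
  proof
    show "normal_cone P F \<subseteq> convex_cone hull (v ` ?A)"
    proof
      fix c assume "c \<in> normal_cone P F"
      then have "c \<bullet> z \<le> c \<bullet> y" if "z \<in> P" for z
        using that y(1) by (auto simp: normal_cone_def)
      from normal_cone_point[OF yP this] show "c \<in> convex_cone hull (v ` ?A)"
        by (simp add: act)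
    qed
    have "convex_cone (normal_cone P F)"
      unfolding convex_cone_def
    proof (intro conjI)
      show "convex (normal_cone P F)"
        unfolding convex_def normal_cone_def
        by (auto simp: inner_add_left intro!: add_mono mult_left_mono)
      show "conic (normal_cone P F)"
        unfolding conic_def normal_cone_def by (auto intro!: mult_left_mono)
      show "normal_cone P F \<noteq> {}"
        unfolding normal_cone_def by (auto intro!: exI[of _ 0])
    qed
    moreover have "v ` ?A \<subseteq> normal_cone P F"
      by (auto simp: normal_cone_def P_def)
    ultimately show "convex_cone hull (v ` ?A) \<subseteq> normal_cone P F"
      by (intro hull_minimal)
  qed
qed

text \<open>The second condition says that the vectors \<open>v T\<close> with \<open>T \<in> \<T>\<close> are linearly independent;
  \<open>d\<close> is the direction of the edge of \<open>P\<close> that leaves the facet of \<open>S\<close>.\<close>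

definition is_vertex :: "'k set \<Rightarrow> bool" where
  "is_vertex \<T> \<longleftrightarrow> (\<exists>y\<in>P. active y = \<T>) \<and>
     (\<forall>S\<in>\<T>. \<exists>d. v S \<bullet> d = - 1 \<and> (\<forall>T\<in>\<T> - {S}. v T \<bullet> d = 0))"

section \<open>Vertices of the polytope and flips along its edges\<close>

lemma vertex_compat_set: "is_vertex \<T> \<Longrightarrow> compat_set \<T>"
  using active_compat_set unfolding is_vertex_def by blast

text \<open>A pivot of the simplex method: \<open>d\<close> is followed from the vertex until a new
  facet \<open>U\<close> blocks the way. A tie between several blocking facets is excluded by
  \<open>pure\<close>, because the active set at the end point is compatible and so has at most
  \<open>card \<T>\<close> elements.\<close>

lemma vertex_flip:
  assumes vert: "is_vertex \<T>" and S: "S \<in> \<T>"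
    and pure: "\<And>\<U>. compat_set \<U> \<Longrightarrow> card \<U> \<le> card \<T>"
  obtains U where "U \<in> K - \<T>" "is_vertex (insert U (\<T> - {S}))"
proof -
  obtain y where y: "y \<in> P" "active y = \<T>" using vert unfolding is_vertex_def by blast
  obtain d where d: "v S \<bullet> d = - 1" "\<And>T. T \<in> \<T> - {S} \<Longrightarrow> v T \<bullet> d = 0"
    using vert S unfolding is_vertex_def by blast
  have fT: "finite \<T>" using finite_active y by blast
  define B where "B = {T \<in> K. v T \<bullet> d > 0}"
  have BT: "B \<inter> \<T> = {}" using d by (force simp: B_def)
  have finB: "finite B" using finite_K by (simp add: B_def)
  have "B \<noteq> {}"
  proof
    assume "B = {}"
    then have neg: "v T \<bullet> d \<le> 0" if "T \<in> K" for T using that by (force simp: B_def)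
    have ray: "y + t *\<^sub>R d \<in> P" if "t \<ge> 0" for t
      unfolding P_def
    proof (intro CollectI ballI)
      fix T assume "T \<in> K"
      then have "t * (v T \<bullet> d) \<le> 0" "v T \<bullet> y \<le> h T"
        using neg that y by (auto simp: P_def mult_nonneg_nonpos)
      then show "v T \<bullet> (y + t *\<^sub>R d) \<le> h T" by (simp add: inner_add_right)
    qed
    obtain b where b: "\<And>x. x \<in> P \<Longrightarrow> norm x \<le> b"
      using bounded_halfspaces unfolding P_def[symmetric] bounded_iff by blast
    have d0: "d \<noteq> 0" using d(1) by auto
    have "norm y \<le> b" using b y(1) by blast
    then have "0 \<le> b" using norm_ge_zero[of y] by linarith
    \<comment> \<open>Long enough to carry \<open>y\<close> farther than the distance of any two
      points of norm at most \<open>b\<close>.\<close>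
    define t where "t = (2 * b + 1) / norm d"
    have "t \<ge> 0" using \<open>0 \<le> b\<close> by (simp add: t_def)
    have "norm (t *\<^sub>R d) = 2 * b + 1"
      using \<open>0 \<le> b\<close> d0 by (simp add: t_def)
    moreover have "norm (t *\<^sub>R d) \<le> norm (y + t *\<^sub>R d) + norm y"
      by (metis add_diff_cancel_left' norm_triangle_ineq4)
    ultimately show False using b[OF ray[OF \<open>t \<ge> 0\<close>]] b[OF y(1)] by linarith
  qed
  define r where "r T = (h T - v T \<bullet> y) / (v T \<bullet> d)" for T
  define t where "t = Min (r ` B)"
  obtain U where U: "U \<in> B" "r U = t"
    using Min_in[of "r ` B"] \<open>B \<noteq> {}\<close> finB unfolding t_def by fastforce
  have tle: "t \<le> r T" if "T \<in> B" for T unfolding t_def using that finB by (intro Min_le) auto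
  have slack: "v T \<bullet> y < h T" if "T \<in> B" for T
    using that BT y by (auto simp: B_def active_def P_def less_le)
  have t0: "t > 0" using slack[OF U(1)] U by (auto simp: r_def B_def)
  define z where "z = y + t *\<^sub>R d"
  have zP: "z \<in> P"
    unfolding P_def
  proof (intro CollectI ballI)
    fix T assume "T \<in> K"
    show "v T \<bullet> z \<le> h T"
    proof (cases "T \<in> B")
      case True
      then show ?thesis using tle[OF True] by (simp add: z_def inner_add_right r_def B_def field_simps)
    next
      case False
      then have "t * (v T \<bullet> d) \<le> 0" "v T \<bullet> y \<le> h T"
        using t0 \<open>T \<in> K\<close> y by (auto simp: B_def P_def mult_nonneg_nonpos)
      then show ?thesis by (simp add: z_def inner_add_right)
    qed
  qed
  have UK: "U \<in> K - \<T>" using U BT by (auto simp: B_def)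
  have Ud: "v U \<bullet> d > 0" using U by (simp add: B_def)
  let ?\<U> = "insert U (\<T> - {S})"
  have sub: "?\<U> \<subseteq> active z"
  proof
    fix T assume "T \<in> ?\<U>"
    then consider "T = U" | "T \<in> \<T> - {S}" by auto
    then show "T \<in> active z"
    proof cases
      case 1
      have "t * (v U \<bullet> d) = h U - v U \<bullet> y" using U(2) Ud by (auto simp: r_def)
      then show ?thesis using UK 1 by (simp add: active_def z_def inner_add_right)
    next
      case 2
      then show ?thesis using y d(2)[OF 2] by (auto simp: active_def z_def inner_add_right)
    qed
  qed
  have "card ?\<U> = Suc (card (\<T> - {S}))" using UK fT by (intro card_insert_disjoint) auto
  then have "card ?\<U> = card \<T>" by (simp only: card_Suc_Diff1[OF fT S])
  then have "card (active z) \<le> card ?\<U>" using pure[OF active_compat_set[OF zP]] by metis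
  then have "active z = ?\<U>" using card_seteq[OF finite_active sub] by metis
  moreover have "\<exists>f. v R \<bullet> f = - 1 \<and> (\<forall>T\<in>?\<U> - {R}. v T \<bullet> f = 0)" if R: "R \<in> ?\<U>" for R
  proof (cases "R = U")
    case True
    have "v T \<bullet> d = 0" if "T \<in> ?\<U> - {R}" for T using that True d(2) by auto
    then show ?thesis using Ud True by (intro exI[of _ "(- 1 / (v U \<bullet> d)) *\<^sub>R d"]) auto
  next
    case False
    then have "R \<in> \<T> - {S}" using R by auto
    then obtain f where f: "v R \<bullet> f = - 1" "\<And>T. T \<in> \<T> - {R} \<Longrightarrow> v T \<bullet> f = 0"
      using vert unfolding is_vertex_def by blast
    \<comment> \<open>Subtracting a multiple of \<open>d\<close> cancels the value at
      \<open>U\<close>; the values at the old members other than \<open>S\<close> stay, since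
      \<open>d\<close> vanishes on them.\<close>
    define g where "g = f - ((v U \<bullet> f) / (v U \<bullet> d)) *\<^sub>R d"
    have "v R \<bullet> g = - 1" using f d(2)[OF \<open>R \<in> \<T> - {S}\<close>] by (simp add: g_def inner_diff_right)
    moreover have "v T \<bullet> g = 0" if "T \<in> ?\<U> - {R}" for T
    proof (cases "T = U")
      case True
      then show ?thesis using Ud by (simp add: g_def inner_diff_right)
    next
      case F: False
      then show ?thesis using that d(2)[of T] f(2)[of T] by (auto simp: g_def inner_diff_right)
    qed
    ultimately show ?thesis by auto
  qed
  ultimately have "is_vertex ?\<U>" using zP unfolding is_vertex_def by blast
  then show thesis using that UK by blast
qed

text \<open>The cone of \<open>\<T>\<close> is the normal cone of the face where all of
  \<open>\<T>\<close> is tight. Any other \<open>S\<close> tight at a vertex of this face becomes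
  strict on the edge that leaves the facet of \<open>S\<close>, and that edge stays in the
  face.\<close>

theorem polytopal_fan:
  assumes vert: "\<And>\<T>. compat_set \<T> \<Longrightarrow> \<exists>\<U>. is_vertex \<U> \<and> \<T> \<subseteq> \<U>"
  shows "polytopal {convex_cone hull (v ` \<T>) |\<T>. compat_set \<T>}"
proof -
  have face: "\<exists>F. F face_of P \<and> F \<noteq> {} \<and> {T \<in> K. \<forall>x\<in>F. v T \<bullet> x = h T} = \<T>"
    if \<T>: "compat_set \<T>" for \<T>
  proof -
    obtain \<U> where \<U>: "is_vertex \<U>" "\<T> \<subseteq> \<U>" using vert[OF \<T>] by blast
    then obtain y where y: "y \<in> P" "active y = \<U>" unfolding is_vertex_def by blast
    have fin: "finite \<T>" "\<T> \<subseteq> K"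
      using \<T> finite_K finite_subset[of \<T> K] by (simp_all add: compat_set_def)
    \<comment> \<open>The sum of the inequalities of \<open>\<T>\<close> is a supporting inequality;
      equality in the sum forces equality in each summand.\<close>
    define F where "F = P \<inter> {x. (\<Sum>T\<in>\<T>. v T) \<bullet> x = (\<Sum>T\<in>\<T>. h T)}"
    have F: "F = {x\<in>P. \<T> \<subseteq> active x}"
    proof -
      have "(\<Sum>T\<in>\<T>. v T) \<bullet> x = (\<Sum>T\<in>\<T>. h T) \<longleftrightarrow> \<T> \<subseteq> active x" if "x \<in> P" for x
      proof -
        have le: "\<forall>T\<in>\<T>. v T \<bullet> x \<le> h T" using that fin by (auto simp: P_def)
        have "(\<Sum>T\<in>\<T>. v T) \<bullet> x = (\<Sum>T\<in>\<T>. h T) \<longleftrightarrow> (\<Sum>T\<in>\<T>. h T - v T \<bullet> x) = 0"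
          by (auto simp: inner_sum_left sum_subtractf)
        also have "\<dots> \<longleftrightarrow> (\<forall>T\<in>\<T>. h T - v T \<bullet> x = 0)"
          using fin(1) le by (intro sum_nonneg_eq_0_iff) auto
        also have "\<dots> \<longleftrightarrow> (\<forall>T\<in>\<T>. v T \<bullet> x = h T)" by (metis eq_iff_diff_eq_0)
        also have "\<dots> \<longleftrightarrow> \<T> \<subseteq> active x" using fin(2) by (auto simp: active_def)
        finally show ?thesis .
      qed
      then show ?thesis by (auto simp: F_def)
    qed
    have "F face_of P"
      unfolding F_def
    proof (rule face_of_Int_supporting_hyperplane_le[OF convex_P])
      show "(\<Sum>T\<in>\<T>. v T) \<bullet> x \<le> (\<Sum>T\<in>\<T>. h T)" if "x \<in> P" for x
        using that fin by (auto simp: inner_sum_left P_def intro!: sum_mono)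
    qed
    moreover have "y \<in> F" using y \<U> F by auto
    moreover have "{T \<in> K. \<forall>x\<in>F. v T \<bullet> x = h T} = \<T>"
    proof
      show "\<T> \<subseteq> {T \<in> K. \<forall>x\<in>F. v T \<bullet> x = h T}" using F fin(2) by (auto simp: active_def)
      show "{T \<in> K. \<forall>x\<in>F. v T \<bullet> x = h T} \<subseteq> \<T>"
      proof (rule ccontr)
        assume "\<not> ?thesis"
        then obtain S where S: "S \<in> K" "\<forall>x\<in>F. v S \<bullet> x = h S" "S \<notin> \<T>" by auto
        then have "S \<in> \<U>" using \<open>y \<in> F\<close> y(2) by (auto simp: active_def)
        then obtain d where d: "v S \<bullet> d = - 1" "\<And>T. T \<in> \<U> - {S} \<Longrightarrow> v T \<bullet> d = 0"
          using \<U> unfolding is_vertex_def by blast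
        have "v T \<bullet> d \<le> 0" if "T \<in> active y" for T
        proof (cases "T = S")
          case False
          then show ?thesis using d(2)[of T] that by (simp add: y(2))
        qed (simp add: d(1))
        then obtain e where
          e: "y + e *\<^sub>R d \<in> P" "active (y + e *\<^sub>R d) = {T \<in> active y. v T \<bullet> d = 0}"
          using small_move[OF y(1), of d] by metis
        have "\<T> \<subseteq> active (y + e *\<^sub>R d)" using d(2) S(3) \<U>(2) unfolding e(2) y(2) by blast
        then have "y + e *\<^sub>R d \<in> F" using e F by auto
        then have "S \<in> active (y + e *\<^sub>R d)" using S by (auto simp: active_def)
        then show False using d(1) unfolding e(2) by simp
      qed
    qed
    ultimately show ?thesis by blast
  qed
  have "P \<noteq> {}"
    using vert[of "{}"] unfolding compat_set_def is_vertex_def by blast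
  moreover have "{convex_cone hull (v ` \<T>) |\<T>. compat_set \<T>} = normal_fan P"
  proof
    show "{convex_cone hull (v ` \<T>) |\<T>. compat_set \<T>} \<subseteq> normal_fan P"
    proof clarify
      fix \<T> assume "compat_set \<T>"
      from face[OF this] obtain F where F: "F face_of P" "F \<noteq> {}"
        "{T \<in> K. \<forall>x\<in>F. v T \<bullet> x = h T} = \<T>" by blast
      have "normal_cone P F = convex_cone hull (v ` \<T>)" using normal_cone_face(1)[OF F(1,2)] F(3) by simp
      then show "convex_cone hull (v ` \<T>) \<in> normal_fan P"
        using F by (auto simp: normal_fan_def)
    qed
    show "normal_fan P \<subseteq> {convex_cone hull (v ` \<T>) |\<T>. compat_set \<T>}"
      using normal_cone_face by (force simp: normal_fan_def)
  qed
  ultimately show ?thesis unfolding polytopal_def using polytope_P by blast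
qed

end

section \<open>Tubings of connected graphs\<close>

lemma tube_iff:
  assumes "pair_graph G"
  shows "tube G T \<longleftrightarrow> T \<subseteq> pverts G \<and> T \<noteq> {} \<and>
    (\<forall>u\<in>T. \<forall>v\<in>T. (u, v) \<in> (parcs G \<inter> T \<times> T)\<^sup>*)"
proof -
  interpret pair_graph G by fact
  have sym: "(v, u) \<in> parcs G" if "(u, v) \<in> parcs G" for u v
    using that by (rule arcs_symmetric)
  let ?H = "mk_symmetric (with_proj G \<restriction> T)"
  have parcs: "parcs ?H = parcs G \<inter> T \<times> T" and verts: "pverts ?H = T"
    using sym by (auto simp: mk_symmetric_def)
  have "(u, v) \<in> rtrancl_on T R \<longleftrightarrow> (u, v) \<in> R\<^sup>*" if "u \<in> T" "R \<subseteq> T \<times> T" for u v :: 'a and R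
  proof
    show "(u, v) \<in> R\<^sup>*" if "(u, v) \<in> rtrancl_on T R"
      using that by (rule rtrancl_on_rtranclI)
    show "(u, v) \<in> rtrancl_on T R" if "(u, v) \<in> R\<^sup>*"
      using that
    proof (induction rule: rtrancl_induct)
      case base
      then show ?case using \<open>u \<in> T\<close> by (rule rtrancl_on_refl)
    next
      case (step y z)
      then show ?case using \<open>R \<subseteq> T \<times> T\<close> by (blast intro: rtrancl_on_into_rtrancl_on)
    qed
  qed
  from this[of _ "parcs G \<inter> T \<times> T"] show ?thesis
    by (auto simp: tube_def Digraph_Component.connected_def strongly_connected_def reachable_def
        parcs verts)
qed

section \<open>Cuts, components and unions of tubes\<close>

definition adjacent :: "'v pair_pre_digraph \<Rightarrow> 'v set \<Rightarrow> 'v set \<Rightarrow> bool" where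
  "adjacent G T U \<longleftrightarrow> (\<exists>t\<in>T. \<exists>u\<in>U. (t, u) \<in> parcs G)"

definition component :: "'v pair_pre_digraph \<Rightarrow> 'v set \<Rightarrow> 'v \<Rightarrow> 'v set" where
  "component G X x = {u. (x, u) \<in> (parcs G \<inter> X \<times> X)\<^sup>*}"

locale connected_pair_graph =
  fixes G :: "'v pair_pre_digraph"
  assumes pair_graph: "pair_graph G"
    and tube_pverts: "tube G (pverts G)"
begin

abbreviation "V \<equiv> pverts G"
abbreviation "E \<equiv> parcs G"

lemma finite_V: "finite V"
  using pair_graph by (simp add: pair_graph_def pair_digraph_def pair_fin_digraph_def
      pair_fin_digraph_axioms_def)

lemma E_sym: "(u, v) \<in> E \<Longrightarrow> (v, u) \<in> E"
  using pair_graph pair_sym_digraph.arcs_symmetric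
  by (metis pair_graph_def pair_pseudo_graph_def)

lemma tube_subset: "tube G T \<Longrightarrow> T \<subseteq> V"
  and tube_nonempty: "tube G T \<Longrightarrow> T \<noteq> {}"
  by (auto simp: tube_iff[OF pair_graph])

lemma finite_tube: "tube G T \<Longrightarrow> finite T"
  using tube_subset finite_V finite_subset by blast

text \<open>Connectedness in its cut form, which later arguments use to produce an edge leaving part
  of a tube.\<close>

lemma tube_cut:
  assumes "tube G T" "Y \<subseteq> T" "Y \<noteq> {}" "Y \<noteq> T"
  obtains y z where "y \<in> Y" "z \<in> T - Y" "(y, z) \<in> E"
proof -
  obtain y0 z0 where y0: "y0 \<in> Y" and z0: "z0 \<in> T - Y" using assms by blast
  have path: "(y0, z0) \<in> (E \<inter> T \<times> T)\<^sup>*"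
    using assms(1,2) y0 z0 by (auto simp: tube_iff[OF pair_graph])
  have "z0 \<in> Y \<or> (\<exists>y\<in>Y. \<exists>z\<in>T - Y. (y, z) \<in> E)"
    using path by (induction rule: rtrancl_induct) (use y0 in auto)
  then show thesis using that z0 by blast
qed

lemma component_props:
  assumes "X \<subseteq> V" "x \<in> X"
  shows "tube G (component G X x)" "x \<in> component G X x" "component G X x \<subseteq> X"
    and component_closed: "\<And>a b. a \<in> component G X x \<Longrightarrow> b \<in> X \<Longrightarrow> (a, b) \<in> E \<Longrightarrow> b \<in> component G X x"
proof -
  let ?A = "component G X x" and ?R = "E \<inter> X \<times> X"
  show x: "x \<in> ?A" by (simp add: component_def)
  show sub: "?A \<subseteq> X"
  proof
    fix u assume "u \<in> ?A"
    then have "(x, u) \<in> ?R\<^sup>*" by (simp add: component_def)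
    then show "u \<in> X" using assms(2) by (induction rule: rtrancl_induct) auto
  qed
  show closed: "b \<in> ?A" if "a \<in> ?A" "b \<in> X" "(a, b) \<in> E" for a b
  proof -
    have "(a, b) \<in> ?R" using that sub by blast
    then show ?thesis using that(1) by (auto simp: component_def intro: rtrancl_into_rtrancl)
  qed
  have from_x: "(x, u) \<in> (E \<inter> ?A \<times> ?A)\<^sup>*" if "u \<in> ?A" for u
  proof -
    have "(x, u) \<in> ?R\<^sup>*" using that by (simp add: component_def)
    then show ?thesis
    proof (induction rule: rtrancl_induct)
      case (step y z)
      then have "y \<in> ?A" "z \<in> ?A" by (auto simp: component_def intro: rtrancl_into_rtrancl)
      then show ?case using step by (blast intro: rtrancl_into_rtrancl)
    qed simp
  qed
  have "sym ((E \<inter> ?A \<times> ?A)\<^sup>*)"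
    by (rule sym_rtrancl) (auto simp: sym_def E_sym)
  then have "(u, x) \<in> (E \<inter> ?A \<times> ?A)\<^sup>*" if "u \<in> ?A" for u
    using from_x[OF that] by (auto dest: symD)
  then have "(u, w) \<in> (E \<inter> ?A \<times> ?A)\<^sup>*" if "u \<in> ?A" "w \<in> ?A" for u w
    using from_x that by (meson rtrancl_trans)
  then show "tube G ?A"
    using x sub assms by (auto simp: tube_iff[OF pair_graph])
qed

lemma tube_Un:
  assumes T: "tube G T" and U: "tube G U" and "T \<inter> U \<noteq> {} \<or> adjacent G T U"
  shows "tube G (T \<union> U)"
proof -
  obtain t where t: "t \<in> T" using tube_nonempty[OF T] by blast
  have TU: "T \<union> U \<subseteq> V" using T U tube_subset by blast
  let ?A = "component G (T \<union> U) t"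
  have A: "tube G ?A" "t \<in> ?A" "?A \<subseteq> T \<union> U"
    by (rule component_props[OF TU], use t in blast)+
  have closed: "b \<in> ?A" if "a \<in> ?A" "b \<in> T \<union> U" "(a, b) \<in> E" for a b
    using component_closed[OF TU, of t] t that by blast
  have absorb: "W \<subseteq> ?A" if W: "tube G W" "W \<subseteq> T \<union> U" "w \<in> W" "w \<in> ?A" for W w
  proof (rule ccontr)
    assume "\<not> W \<subseteq> ?A"
    then obtain y z where "y \<in> W \<inter> ?A" "z \<in> W - (W \<inter> ?A)" "(y, z) \<in> E"
      using tube_cut[of W "W \<inter> ?A"] W by blast
    then show False using closed W(2) by blast
  qed
  have "T \<subseteq> ?A" using absorb[OF T _ t A(2)] by blast
  moreover have "\<exists>u\<in>U. u \<in> ?A"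
    using assms(3) \<open>T \<subseteq> ?A\<close> closed unfolding adjacent_def by blast
  then have "U \<subseteq> ?A" using absorb[OF U] by blast
  ultimately have "?A = T \<union> U" using A(3) by blast
  then show ?thesis using A(1) by simp
qed

definition far :: "'v set \<Rightarrow> 'v set \<Rightarrow> bool" where
  "far T U \<longleftrightarrow> T \<inter> U = {} \<and> \<not> adjacent G T U"

lemma adjacent_sym: "adjacent G T U \<longleftrightarrow> adjacent G U T"
  unfolding adjacent_def using E_sym by blast

lemma far_sym: "far T U \<longleftrightarrow> far U T"
  unfolding far_def using adjacent_sym by blast

lemma far_mono: "far T U \<Longrightarrow> T' \<subseteq> T \<Longrightarrow> far T' U"
  unfolding far_def adjacent_def by blast

text \<open>The union of disjoint tubes is a tube just when an edge joins them, so compatibility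
  becomes a condition on single edges.\<close>

lemma compatible_iff:
  assumes "tube G T" "tube G U"
  shows "tubes_compatible G T U \<longleftrightarrow> T \<subseteq> U \<or> U \<subseteq> T \<or> far T U"
proof (cases "T \<inter> U = {}")
  case True
  have "tube G (T \<union> U) \<longleftrightarrow> adjacent G T U"
  proof
    assume "tube G (T \<union> U)"
    moreover have "T \<noteq> T \<union> U" using True tube_nonempty[OF assms(2)] by blast
    ultimately obtain y z where "y \<in> T" "z \<in> (T \<union> U) - T" "(y, z) \<in> E"
      using tube_cut[of "T \<union> U" T] tube_nonempty[OF assms(1)] by blast
    then show "adjacent G T U" unfolding adjacent_def by blast
  qed (use tube_Un assms in blast)
  then show ?thesis using True by (auto simp: tubes_compatible_def far_def)
qed (auto simp: tubes_compatible_def far_def)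

lemma compatible_sym: "tubes_compatible G T U \<Longrightarrow> tubes_compatible G U T"
  unfolding tubes_compatible_def by (metis Int_commute Un_commute)

lemma tube_component_cases:
  assumes "X \<subseteq> V" "x \<in> X" "tube G U" "U \<subseteq> X"
  shows "U \<subseteq> component G X x \<or> far U (component G X x)"
proof (cases "U \<inter> component G X x = {}")
  case True
  have "\<not> adjacent G U (component G X x)"
    unfolding adjacent_def
    using True component_closed[OF assms(1,2)] assms(4) E_sym by blast
  then show ?thesis using True by (simp add: far_def)
next
  case False
  have "U \<subseteq> component G X x"
  proof (rule ccontr)
    assume "\<not> ?thesis"
    then obtain y z where "y \<in> U \<inter> component G X x" "z \<in> U - U \<inter> component G X x" "(y, z) \<in> E"
      using tube_cut[of U "U \<inter> component G X x"] assms(3) False by blast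
    then show False using component_closed[OF assms(1,2)] assms(4) by blast
  qed
  then show ?thesis by simp
qed

text \<open>A connected graph has \<open>V\<close> as its single component.\<close>

lemma proper_tube_iff: "proper_tube G T \<longleftrightarrow> tube G T \<and> T \<noteq> V"
proof -
  interpret pair_graph G by (rule pair_graph)
  have reach: "u \<rightarrow>\<^sup>*\<^bsub>with_proj G\<^esub> v" if "u \<in> V" "v \<in> V" for u v
  proof -
    have "(u, v) \<in> (E \<inter> V \<times> V)\<^sup>*" using tube_pverts that by (auto simp: tube_iff[OF pair_graph])
    then show ?thesis
    proof (induction rule: rtrancl_induct)
      case base
      then show ?case using that by simp
    next
      case (step y z)
      then have yz: "(y, z) \<in> E" by blast
      show ?case by (rule reachable_adj_trans[OF step(3) yz])
    qed
  qed
  have "T \<in> sccs_verts \<longleftrightarrow> T = V" if tT: "tube G T"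
  proof
    assume T: "T \<in> sccs_verts"
    show "T = V"
    proof (rule ccontr)
      assume "T \<noteq> V"
      then obtain v where v: "v \<in> V" "v \<notin> T" using tube_subset[OF tT] by blast
      obtain u where u: "u \<in> T" using tube_nonempty[OF tT] by blast
      then have "u \<in> V" using tube_subset[OF tT] by blast
      then show False using T u v reach unfolding in_sccs_verts_conv_reachable by blast
    qed
  next
    assume "T = V"
    then show "T \<in> sccs_verts"
      unfolding in_sccs_verts_conv_reachable
      using reach tube_nonempty[OF tT] reachable_in_verts by blast
  qed
  then show ?thesis by (auto simp: proper_tube_def)
qed

section \<open>Maximal tubings: roots, smallest tubes and cardinality\<close>

lemma tubingD:
  assumes "tubing G \<T>" "T \<in> \<T>"
  shows "tube G T" "T \<noteq> V" "T \<subseteq> V"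
  using assms tube_subset by (auto simp: tubing_def proper_tube_iff)

lemma tubing_cases:
  assumes "tubing G \<T>" "T \<in> \<T>" "U \<in> \<T>"
  shows "T \<subseteq> U \<or> U \<subseteq> T \<or> far T U"
  using assms compatible_iff[OF tubingD(1)[OF assms(1,2)] tubingD(1)[OF assms(1,3)]]
  by (auto simp: tubing_def)

lemma finite_tubing: "tubing G \<T> \<Longrightarrow> finite \<T>"
  by (rule finite_subset[of _ "Pow V"]) (use tubingD(3) finite_V in auto)

lemma tubing_insert:
  assumes "tubing G \<T>" "tube G U" "U \<noteq> V" "\<And>T. T \<in> \<T> \<Longrightarrow> tubes_compatible G U T"
  shows "tubing G (insert U \<T>)"
proof -
  have "tubes_compatible G U U" by (simp add: tubes_compatible_def)
  then show ?thesis
    using assms compatible_sym unfolding tubing_def proper_tube_iff by blast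
qed

lemma maximal_tubing_absorb:
  assumes "maximal_tubing G \<T>" "tube G U" "U \<noteq> V" "\<And>T. T \<in> \<T> \<Longrightarrow> tubes_compatible G U T"
  shows "U \<in> \<T>"
  using assms tubing_insert[of \<T> U] unfolding maximal_tubing_def by blast

lemma component_in_maximal_tubing:
  assumes max: "maximal_tubing G \<T>" and T: "T \<in> insert V \<T>" and s: "s \<in> T"
    and smaller: "\<And>S. S \<in> \<T> \<Longrightarrow> S \<subset> T \<Longrightarrow> s \<notin> S" and v: "v \<in> T - {s}"
  shows "component G (T - {s}) v \<in> \<T>" (is "?A \<in> _")
proof (rule maximal_tubing_absorb[OF max])
  have tub: "tubing G \<T>" using max by (simp add: maximal_tubing_def)
  have TV: "T - {s} \<subseteq> V" using T tubingD(3)[OF tub] by auto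
  have A: "tube G ?A" "?A \<subseteq> T - {s}" using component_props[OF TV v] by auto
  show "tube G ?A" by (rule A)
  have "s \<in> V" using T s tubingD(3)[OF tub] by blast
  then show "?A \<noteq> V" using A(2) by blast
  fix X assume X: "X \<in> \<T>"
  have tX: "tube G X" using tubingD(1)[OF tub X] .
  consider "X \<subset> T" | "T \<subseteq> X" | "far T X"
  proof (cases "T = V")
    case True
    then show thesis using that tubingD(3)[OF tub X] by blast
  next
    case False
    then have "T \<in> \<T>" using T by blast
    then show thesis using tubing_cases[OF tub _ X, of T] that by blast
  qed
  then have "?A \<subseteq> X \<or> X \<subseteq> ?A \<or> far ?A X"
  proof cases
    case 1
    then have "X \<subseteq> T - {s}" using smaller[OF X] by blast
    then show ?thesis
      using tube_component_cases[OF TV v tX] far_sym by blast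
  next
    case 2
    then show ?thesis using A(2) by blast
  next
    case 3
    then show ?thesis using far_mono A(2) by blast
  qed
  then show "tubes_compatible G ?A X" using compatible_iff[OF A(1) tX] by blast
qed

text \<open>Tubes of a tubing with a common vertex are nested, so those around \<open>v\<close> form
  a chain.\<close>

lemma smallest_tube:
  assumes tub: "tubing G \<T>" and v: "v \<in> V"
  shows "\<exists>T\<in>insert V \<T>. v \<in> T \<and> (\<forall>S\<in>insert V \<T>. v \<in> S \<longrightarrow> T \<subseteq> S)"
proof -
  let ?X = "{T \<in> insert V \<T>. v \<in> T}"
  have "finite ?X" "?X \<noteq> {}" using finite_tubing[OF tub] v by auto
  from finite_has_minimal[OF this]
  obtain T where T: "T \<in> ?X" "\<forall>S\<in>?X. S \<subseteq> T \<longrightarrow> T = S" ..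
  have "T \<subseteq> S" if S: "S \<in> ?X" for S
  proof -
    have "T \<subseteq> S \<or> S \<subseteq> T"
    proof (cases "T = V \<or> S = V")
      case True
      then show ?thesis using T(1) S tubingD(3)[OF tub] by blast
    next
      case False
      then have "T \<in> \<T>" "S \<in> \<T>" using T(1) S by auto
      then have "T \<subseteq> S \<or> S \<subseteq> T \<or> far T S" by (rule tubing_cases[OF tub])
      then show ?thesis using T(1) S unfolding far_def by blast
    qed
    then show ?thesis using T(2) S by blast
  qed
  then show ?thesis using T(1) by blast
qed

text \<open>The maximal tubes strictly inside \<open>T\<close> are pairwise far, so an edge of
  \<open>T\<close> leaving one of them cannot end in another; its end is a root.\<close>

lemma tube_root:
  assumes tub: "tubing G \<T>" and T: "T \<in> insert V \<T>"
  shows "\<exists>r\<in>T. \<forall>S\<in>\<T>. S \<subset> T \<longrightarrow> r \<notin> S"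
proof (cases "\<exists>S\<in>\<T>. S \<subset> T")
  case False
  have "tube G T" using T tubingD(1)[OF tub] tube_pverts by blast
  then show ?thesis using tube_nonempty False by blast
next
  case True
  have tT: "tube G T" using T tubingD(1)[OF tub] tube_pverts by blast
  let ?X = "{S \<in> \<T>. S \<subset> T}"
  have fX: "finite ?X" using finite_tubing[OF tub] by simp
  have maxel: "\<exists>B\<in>?X. S \<subseteq> B \<and> (\<forall>S'\<in>?X. B \<subseteq> S' \<longrightarrow> B = S')" if "S \<in> ?X" for S
    using finite_has_maximal2[OF fX that] .
  obtain A where A: "A \<in> ?X" "\<forall>S\<in>?X. A \<subseteq> S \<longrightarrow> A = S"
    using True maxel by (metis (no_types, lifting) mem_Collect_eq)
  have tA: "tube G A" using A(1) tubingD(1)[OF tub] by blast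
  have "A \<subseteq> T" "A \<noteq> T" using A(1) by auto
  then obtain y z where yz: "y \<in> A" "z \<in> T - A" "(y, z) \<in> E"
    by (rule tube_cut[OF tT _ tube_nonempty[OF tA]])
  have "z \<notin> S" if S: "S \<in> \<T>" "S \<subset> T" for S
  proof
    assume zS: "z \<in> S"
    obtain B where B: "B \<in> ?X" "S \<subseteq> B" "\<forall>S'\<in>?X. B \<subseteq> S' \<longrightarrow> B = S'"
      using maxel[of S] S by blast
    have "A \<noteq> B" using zS B(2) yz by blast
    have "A \<in> \<T>" "B \<in> \<T>" using A(1) B(1) by auto
    then have "A \<subseteq> B \<or> B \<subseteq> A \<or> far A B"
      by (rule tubing_cases[OF tub])
    then have "far A B" using A B \<open>A \<noteq> B\<close> by blast
    then show False using yz zS B(2) unfolding far_def adjacent_def by blast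
  qed
  then show ?thesis using yz by blast
qed

text \<open>Roots are distinct: two tubes with the same root would be nested, and the root of the
  larger lies outside the smaller.\<close>

lemma card_tubing:
  assumes tub: "tubing G \<T>"
  shows "card \<T> + 1 \<le> card V"
proof -
  obtain r where r: "\<And>T. T \<in> insert V \<T> \<Longrightarrow> r T \<in> T"
    "\<And>T S. T \<in> insert V \<T> \<Longrightarrow> S \<in> \<T> \<Longrightarrow> S \<subset> T \<Longrightarrow> r T \<notin> S"
    using tube_root[OF tub] by metis
  have "inj_on r (insert V \<T>)"
  proof (rule inj_onI, rule ccontr)
    fix T S assume TS: "T \<in> insert V \<T>" "S \<in> insert V \<T>" "r T = r S" "T \<noteq> S"
    have "T \<inter> S \<noteq> {}" using r(1)[OF TS(1)] r(1)[OF TS(2)] TS(3) by auto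
    then have "T \<subseteq> S \<or> S \<subseteq> T"
      using TS(1,2) tubing_cases[OF tub, of T S] tubingD(3)[OF tub] unfolding far_def by blast
    then show False
    proof
      assume "T \<subseteq> S"
      then have "T \<in> \<T>" using TS tubingD(3)[OF tub] by blast
      then show False using r(2)[OF TS(2), of T] r(1)[OF TS(1)] TS \<open>T \<subseteq> S\<close> by auto
    next
      assume "S \<subseteq> T"
      then have "S \<in> \<T>" using TS tubingD(3)[OF tub] by blast
      then show False using r(2)[OF TS(1), of S] r(1)[OF TS(2)] TS \<open>S \<subseteq> T\<close> by auto
    qed
  qed
  moreover have "r ` insert V \<T> \<subseteq> V" using r(1) tubingD(3)[OF tub] by auto
  ultimately have "card (insert V \<T>) \<le> card V" by (rule card_inj_on_le) (rule finite_V)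
  moreover have "V \<notin> \<T>" using tubingD(2)[OF tub] by blast
  ultimately show ?thesis using finite_tubing[OF tub] by simp
qed

text \<open>Sending a vertex to the smallest tube around it is injective: if \<open>v\<close> and
  \<open>w\<close> shared this tube, the component of \<open>w\<close> after deleting
  \<open>v\<close> would be a smaller tube around \<open>w\<close>.\<close>

lemma card_maximal_tubing:
  assumes max: "maximal_tubing G \<T>"
  shows "card \<T> + 1 = card V"
proof -
  have tub: "tubing G \<T>" using max by (simp add: maximal_tubing_def)
  obtain f where f: "\<And>v. v \<in> V \<Longrightarrow> f v \<in> insert V \<T>" "\<And>v. v \<in> V \<Longrightarrow> v \<in> f v"
    "\<And>v S. v \<in> V \<Longrightarrow> S \<in> insert V \<T> \<Longrightarrow> v \<in> S \<Longrightarrow> f v \<subseteq> S"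
    using smallest_tube[OF tub] by metis
  have "inj_on f V"
  proof (rule inj_onI, rule ccontr)
    fix v w assume vw: "v \<in> V" "w \<in> V" "f v = f w" "v \<noteq> w"
    let ?A = "component G (f v - {v}) w"
    have w: "w \<in> f v - {v}" using f(2)[OF vw(2)] vw by auto
    have sub: "f v - {v} \<subseteq> V" using f(1)[OF vw(1)] tubingD(3)[OF tub] by auto
    have "?A \<in> \<T>"
    proof (rule component_in_maximal_tubing[OF max f(1)[OF vw(1)] f(2)[OF vw(1)] _ w])
      fix S assume "S \<in> \<T>" "S \<subset> f v"
      then show "v \<notin> S" using f(3)[OF vw(1), of S] by blast
    qed
    then have "f w \<subseteq> ?A" using f(3)[OF vw(2)] component_props(2)[OF sub w] by blast
    then show False using component_props(3)[OF sub w] f(2)[OF vw(1)] vw(3) by blast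
  qed
  moreover have "f ` V \<subseteq> insert V \<T>" using f(1) by blast
  ultimately have "card V \<le> card (insert V \<T>)"
    by (rule card_inj_on_le) (use finite_tubing[OF tub] in simp)
  also have "\<dots> \<le> card \<T> + 1" using card_insert_le_m1[of "card \<T> + 1"] finite_tubing[OF tub]
    by (simp add: card_insert_if)
  finally show ?thesis using card_tubing[OF tub] by simp
qed

section \<open>Flips between maximal tubings\<close>

lemma extend_tubing:
  assumes "tubing G \<T>"
  obtains \<S> where "maximal_tubing G \<S>" "\<T> \<subseteq> \<S>"
proof -
  have "{\<S>. tubing G \<S>} \<subseteq> Pow (Pow V)" using tubingD(3) by blast
  then have "finite {\<S>. tubing G \<S>}" using finite_V finite_subset by blast
  then obtain \<S> where \<S>: "\<S> \<in> {\<S>. tubing G \<S>}" "\<T> \<subseteq> \<S>"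
    "\<forall>\<U>\<in>{\<S>. tubing G \<S>}. \<S> \<subseteq> \<U> \<longrightarrow> \<S> = \<U>"
    using finite_has_maximal2[of "{\<S>. tubing G \<S>}" \<T>] assms by auto
  then have "maximal_tubing G \<S>" unfolding maximal_tubing_def by blast
  then show thesis using \<S>(2) that by blast
qed

text \<open>If \<open>U\<close> contained \<open>s\<close>, an edge would join it to every component
  of \<open>T - {s}\<close>. These components belong to the tubing, so \<open>U\<close> would have
  to contain each of them, hence \<open>T\<close>; being compatible with all of \<open>\<T>\<close>,
  it would already be a member.\<close>

lemma flip_avoids:
  assumes max: "maximal_tubing G \<T>" and T: "T \<in> \<T>" and s: "s \<in> T"
    and smaller: "\<And>S. S \<in> \<T> \<Longrightarrow> S \<subset> T \<Longrightarrow> s \<notin> S"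
    and U: "tubing G (insert U (\<T> - {T}))" "U \<notin> \<T>"
  shows "s \<notin> U"
proof
  assume sU: "s \<in> U"
  have tub: "tubing G \<T>" using max by (simp add: maximal_tubing_def)
  have tU: "tube G U" "U \<noteq> V" using tubingD[OF U(1), of U] by auto
  have tT: "tube G T" "T \<subseteq> V" using tubingD[OF tub T] by auto
  have comp: "tubes_compatible G U S" if "S \<in> \<T> - {T}" for S
    using that U(1) by (auto simp: tubing_def)
  have "T \<subseteq> U"
  proof
    fix v assume v: "v \<in> T"
    show "v \<in> U"
    proof (cases "v = s")
      case False
      let ?A = "component G (T - {s}) v"
      have TV: "T - {s} \<subseteq> V" and vT: "v \<in> T - {s}" using tT v False by auto
      have A: "tube G ?A" "v \<in> ?A" "?A \<subseteq> T - {s}" using component_props[OF TV vT] by auto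
      have "?A \<in> \<T>"
        using component_in_maximal_tubing[OF max _ s smaller vT] T by blast
      then have "?A \<in> \<T> - {T}" using A(3) s by auto
      then have "U \<subseteq> ?A \<or> ?A \<subseteq> U \<or> far U ?A"
        using comp compatible_iff[OF tU(1) A(1)] by blast
      moreover obtain y z where yz: "y \<in> ?A" "z \<in> T - ?A" "(y, z) \<in> E"
        using tube_cut[OF tT(1), of ?A] A s by blast
      have "z = s" using component_closed[OF TV vT yz(1) _ yz(3)] yz(2) by blast
      then have "\<not> far U ?A" using yz sU E_sym by (auto simp: far_def adjacent_def)
      ultimately show ?thesis using A sU by blast
    qed (use sU in simp)
  qed
  then have "tubes_compatible G U T" by (simp add: tubes_compatible_def)
  then have "U \<in> \<T>" using maximal_tubing_absorb[OF max tU] comp by blast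
  then show False using U(2) by simp
qed

text \<open>The target \<open>\<S>\<close> is reached from the outside in: to create a tube \<open>S\<close> of \<open>\<S>\<close> below
  its parent \<open>Q\<close>, with root \<open>s\<close>, one flips away the tubes strictly inside \<open>Q\<close> that contain
  \<open>s\<close>, the smallest one first.\<close>

lemma flip_connected:
  assumes good: "\<And>\<T>. good \<T> \<Longrightarrow> maximal_tubing G \<T>" "\<exists>\<T>. good \<T>"
    and flip: "\<And>\<T> T. good \<T> \<Longrightarrow> T \<in> \<T> \<Longrightarrow> \<exists>U. U \<notin> \<T> \<and> good (insert U (\<T> - {T}))"
    and tub: "tubing G \<R>"
  shows "\<exists>\<T>. good \<T> \<and> \<R> \<subseteq> \<T>"
proof -
  obtain \<S> where \<S>: "maximal_tubing G \<S>" "\<R> \<subseteq> \<S>" using extend_tubing[OF tub] .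
  then have tubS: "tubing G \<S>" by (simp add: maximal_tubing_def)
  have inner: "\<exists>\<T>'. good \<T>' \<and> insert S (\<T> \<inter> \<S>) \<subseteq> \<T>'"
    if S: "S \<in> \<S>" "Q \<in> insert V \<S>" "S \<subset> Q" "\<And>R. R \<in> \<S> \<Longrightarrow> S \<subset> R \<Longrightarrow> \<not> R \<subset> Q"
      and \<T>: "good \<T>" "Q \<in> insert V \<T>" for S Q \<T>
  proof -
    have tQ: "tube G Q" "Q \<subseteq> V" using S(2) tubingD[OF tubS] tube_pverts by auto
    have tS: "tube G S" using S(1) tubingD[OF tubS] by blast
    obtain x s where xs: "x \<in> S" "s \<in> Q - S" "(x, s) \<in> E"
      using tube_cut[OF tQ(1), of S] S(3) tube_nonempty[OF tS] by blast
    \<comment> \<open>A tube of \<open>\<S>\<close> strictly inside \<open>Q\<close> and through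
      \<open>s\<close> would be nested with \<open>S\<close>, as \<open>x\<close> and
      \<open>s\<close> are adjacent, and so lie strictly between \<open>S\<close> and
      \<open>Q\<close>. Hence the flips below never remove a tube of \<open>\<S>\<close>.\<close>
    have no_s: "s \<notin> R" if R: "R \<in> \<S>" "R \<subset> Q" for R
    proof
      assume "s \<in> R"
      have "S \<subseteq> R \<or> R \<subseteq> S \<or> far S R" using tubing_cases[OF tubS S(1) R(1)] by blast
      moreover have "\<not> far S R" using xs \<open>s \<in> R\<close> by (auto simp: far_def adjacent_def)
      ultimately show False using \<open>s \<in> R\<close> xs S(4)[OF R(1)] R(2) by blast
    qed
    have QV: "Q - {s} \<subseteq> V" and xQ: "x \<in> Q - {s}" using tQ xs S(3) by auto
    have comp: "component G (Q - {s}) x = S"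
    proof -
      have "component G (Q - {s}) x \<in> \<S>"
        using component_in_maximal_tubing[OF \<S>(1) S(2) _ no_s xQ] xs by blast
      moreover have "S \<subseteq> Q - {s}" using S(3) xs by blast
      then have "S \<subseteq> component G (Q - {s}) x"
        using tube_component_cases[OF QV xQ tS] component_props(2)[OF QV xQ] xs(1)
        by (auto simp: far_def)
      moreover have "component G (Q - {s}) x \<subset> Q"
        using component_props(3)[OF QV xQ] xs by blast
      ultimately show ?thesis using S(4) by blast
    qed
    \<comment> \<open>Each flip lowers the number of tubes through \<open>s\<close>, since the new
      tube avoids \<open>s\<close>. Once \<open>Q\<close> is the smallest tube around
      \<open>s\<close>, maximality supplies the component \<open>S\<close>.\<close>
    show ?thesis using \<T>
    proof (induction "card {T \<in> \<T>. s \<in> T}" arbitrary: \<T> rule: less_induct)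
      case less
      have max: "maximal_tubing G \<T>" using good(1)[OF less.prems(1)] .
      then have tubT: "tubing G \<T>" by (simp add: maximal_tubing_def)
      have "s \<in> V" using xs tQ by blast
      then obtain T where T: "T \<in> insert V \<T>" "s \<in> T"
        "\<And>R. R \<in> insert V \<T> \<Longrightarrow> s \<in> R \<Longrightarrow> T \<subseteq> R"
        using smallest_tube[OF tubT] by metis
      have smaller: "s \<notin> R" if "R \<in> \<T>" "R \<subset> T" for R using T(3)[of R] that by blast
      show ?case
      proof (cases "T = Q")
        case True
        then have "S \<in> \<T>"
          using component_in_maximal_tubing[OF max T(1,2) smaller] xQ comp by blast
        then show ?thesis using less.prems by blast
      next
        case False
        have "T \<subseteq> Q" using T(3)[OF less.prems(2)] xs by blast
        then have "T \<subset> Q" using False by blast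
        then have "T \<in> \<T>" "T \<notin> \<S>" using T tQ no_s by auto
        then obtain U where U: "U \<notin> \<T>" "good (insert U (\<T> - {T}))"
          using flip[OF less.prems(1)] by blast
        let ?\<T> = "insert U (\<T> - {T})"
        have "tubing G ?\<T>" using good(1)[OF U(2)] by (simp add: maximal_tubing_def)
        then have "s \<notin> U" using flip_avoids[OF max \<open>T \<in> \<T>\<close> T(2) smaller _ U(1)] by blast
        then have "{R \<in> ?\<T>. s \<in> R} \<subset> {R \<in> \<T>. s \<in> R}" using T(2) \<open>T \<in> \<T>\<close> by blast
        then have "card {R \<in> ?\<T>. s \<in> R} < card {R \<in> \<T>. s \<in> R}"
          using finite_tubing[OF tubT] by (intro psubset_card_mono) auto
        moreover have "Q \<in> insert V ?\<T>" using less.prems(2) False by blast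
        ultimately obtain \<T>' where "good \<T>'" "insert S (?\<T> \<inter> \<S>) \<subseteq> \<T>'"
          using less.hyps[OF _ U(2)] by blast
        then show ?thesis using \<open>T \<notin> \<S>\<close> by blast
      qed
    qed
  qed
  have "\<exists>\<T>'. good \<T>' \<and> \<S> \<subseteq> \<T>'" if "good \<T>" for \<T>
    using that
  proof (induction "card (\<S> - \<T>)" arbitrary: \<T> rule: less_induct)
    case less
    show ?case
    proof (cases "\<S> \<subseteq> \<T>")
      case False
      have fin: "finite (\<S> - \<T>)" using finite_tubing[OF tubS] by simp
      moreover have "\<S> - \<T> \<noteq> {}" using False by blast
      \<comment> \<open>A maximal missing tube has its parent in \<open>insert V \<S>\<close>
        already present, as \<open>inner\<close> requires.\<close>
      ultimately obtain S where S: "S \<in> \<S> - \<T>" "\<forall>R\<in>\<S> - \<T>. S \<subseteq> R \<longrightarrow> S = R"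
        using finite_has_maximal[of "\<S> - \<T>"] by metis
      let ?X = "{Q \<in> insert V \<S>. S \<subset> Q}"
      have "S \<noteq> V" "S \<subseteq> V" using tubingD(2,3)[OF tubS, of S] S(1) by auto
      then have "V \<in> ?X" by blast
      moreover have "finite ?X" using finite_tubing[OF tubS] by simp
      ultimately obtain Q where Q: "Q \<in> ?X" "\<forall>R\<in>?X. R \<subseteq> Q \<longrightarrow> Q = R"
        using finite_has_minimal[of ?X] by (metis (no_types, lifting) empty_iff)
      have "Q \<in> insert V \<T>" using Q(1) S(2) by blast
      moreover have "\<not> R \<subset> Q" if "R \<in> \<S>" "S \<subset> R" for R using Q(2) that by blast
      ultimately obtain \<T>' where \<T>': "good \<T>'" "insert S (\<T> \<inter> \<S>) \<subseteq> \<T>'"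
        using inner[of S Q \<T>] S(1) Q(1) less.prems by (metis (no_types, lifting) DiffD1 mem_Collect_eq)
      have "\<S> - \<T>' \<subset> \<S> - \<T>" using \<T>'(2) S(1) by blast
      then have "card (\<S> - \<T>') < card (\<S> - \<T>)" using fin psubset_card_mono by blast
      then show ?thesis using less.hyps[OF _ \<T>'(1)] by blast
    qed (use less.prems in blast)
  qed
  then show ?thesis using good(2) \<S>(2) by blast
qed

section \<open>Signs of compatibility degrees\<close>

lemma compatibility_degree_pos:
  assumes T: "tube G T" and U: "tube G U" and "\<not> tubes_compatible G T U"
  shows "compatibility_degree G T U > 0"
proof -
  have TU: "T \<noteq> U" "\<not> T \<subseteq> U" "\<not> U \<subseteq> T" "\<not> far T U"
    using assms compatible_iff[OF T U] by auto
  let ?N = "{v \<in> U - T. \<exists>u\<in>T. (u, v) \<in> E}"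
  have "?N \<noteq> {}"
  proof (cases "U \<inter> T = {}")
    case True
    then show ?thesis using TU(4) by (auto simp: far_def adjacent_def)
  next
    case False
    then obtain y z where "y \<in> U \<inter> T" "z \<in> U - U \<inter> T" "(y, z) \<in> E"
      using tube_cut[OF U, of "U \<inter> T"] TU by blast
    then show ?thesis by blast
  qed
  moreover have "finite ?N" using finite_tube[OF U] by simp
  ultimately show ?thesis using TU by (simp add: compatibility_degree_def card_gt_0_iff)
qed

lemma compatibility_degree_zero:
  assumes T: "tube G T" and U: "tube G U" and "tubes_compatible G T U" "T \<noteq> U"
  shows "compatibility_degree G T U = 0"
proof -
  have N: "{v \<in> U - T. \<exists>u\<in>T. (u, v) \<in> E} = {}" if "\<not> T \<subseteq> U"
    using that assms compatible_iff[OF T U] by (auto simp: far_def adjacent_def)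
  show ?thesis
  proof (cases "T \<subseteq> U")
    case False
    show ?thesis unfolding compatibility_degree_def N[OF False] using assms(4) by simp
  qed (use assms(4) in \<open>simp add: compatibility_degree_def\<close>)
qed

text \<open>A single vertex next to \<open>T\<close> will do. For each initial tube this yields a
  generator that is positive in its coordinate, which later bounds the polytope from above in that
  direction.\<close>

lemma incompatible_proper_tube:
  assumes "proper_tube G T"
  obtains U where "proper_tube G U" "\<not> tubes_compatible G T U"
proof -
  have T: "tube G T" "T \<noteq> V" "T \<subseteq> V" "T \<noteq> {}"
    using assms tube_subset tube_nonempty by (auto simp: proper_tube_iff)
  obtain y z where yz: "y \<in> T" "z \<in> V - T" "(y, z) \<in> E"
    using tube_cut[OF tube_pverts, of T] T by blast
  have U: "tube G {z}" using yz by (auto simp: tube_iff[OF pair_graph])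
  moreover have "{z} \<noteq> V"
  proof
    assume "{z} = V"
    then have "y = z" using yz(1) T(3) by blast
    then show False using yz by blast
  qed
  moreover have "\<not> far T {z}" using yz by (auto simp: far_def adjacent_def)
  then have "\<not> tubes_compatible G T {z}"
    using compatible_iff[OF T(1) U] yz T by blast
  ultimately show thesis using that by (simp add: proper_tube_iff)
qed

end

section \<open>Chords of a polygon\<close>

definition crosses :: "nat \<times> nat \<Rightarrow> nat \<times> nat \<Rightarrow> bool" where
  "crosses c d \<longleftrightarrow> fst c < fst d \<and> fst d < snd c \<and> snd c < snd d \<or>
                    fst d < fst c \<and> fst c < snd d \<and> snd d < snd c"

definition crossing :: "nat \<times> nat \<Rightarrow> nat \<times> nat \<Rightarrow> real" where
  "crossing c d = of_bool (crosses c d)"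

lemma crosses_sym: "crosses c d \<longleftrightarrow> crosses d c"
  by (auto simp: crosses_def)

section \<open>Crossings with the sides and diagonals of a quadrilateral\<close>

lemma quad_position:
  fixes p q r s a :: nat
  assumes "p < q" "q < r" "r < s"
  obtains "a < p" | "a = p" | "p < a" "a < q" | "a = q" | "q < a" "a < r" | "a = r"
    | "r < a" "a < s" | "a = s" | "s < a"
  using assms by linarith

text \<open>The exceptions join the arc from \<open>q\<close> to \<open>r\<close> with the arc from
  \<open>s\<close> round to \<open>p\<close>: they pass between the sides \<open>pq\<close> and
  \<open>rs\<close> without crossing them. The linear numbering splits the second arc into a part up
  to \<open>p\<close> and a part from \<open>s\<close> on.\<close>

lemma quad_sides_A:
  fixes p q r s a b :: nat
  assumes "p < q" "q < r" "r < s" "a < b" "(a, b) \<noteq> (p, r)" "(a, b) \<noteq> (q, s)"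
    and "crossing (p, r) (a, b) + crossing (q, s) (a, b) \<noteq> crossing (p, q) (a, b) + crossing (r, s) (a, b)"
  shows "a = p \<and> q < b \<and> b < r \<or> q < a \<and> a < r \<and> b = s \<or>
    a < p \<and> q \<le> b \<and> b \<le> r \<or> q \<le> a \<and> a \<le> r \<and> s < b"
  by (rule quad_position[OF assms(1-3), of a]; rule quad_position[OF assms(1-3), of b];
      use assms in \<open>simp add: crossing_def crosses_def\<close>)

text \<open>The same for the arcs from \<open>p\<close> to \<open>q\<close> and from
  \<open>r\<close> to \<open>s\<close>, which the numbering does not split.\<close>

lemma quad_sides_B:
  fixes p q r s a b :: nat
  assumes "p < q" "q < r" "r < s" "a < b" "(a, b) \<noteq> (p, r)" "(a, b) \<noteq> (q, s)"
    and "crossing (p, r) (a, b) + crossing (q, s) (a, b) \<noteq> crossing (q, r) (a, b) + crossing (p, s) (a, b)"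
  shows "a = p \<and> r < b \<and> b < s \<or> p < a \<and> a < q \<and> r \<le> b \<and> b \<le> s \<or> a = q \<and> r < b \<and> b < s"
  by (rule quad_position[OF assms(1-3), of a]; rule quad_position[OF assms(1-3), of b];
      use assms in \<open>simp add: crossing_def crosses_def\<close>)

text \<open>The chords from \<open>p\<close> to \<open>x\<close> and \<open>y\<close> on both sides
  of \<open>pr\<close> confine all others: one that crosses \<open>pr\<close> cuts off the corner
  \<open>r\<close>, so it crosses both sides at \<open>r\<close> and misses \<open>qs\<close>; one
  that misses \<open>pr\<close> but crosses \<open>qs\<close> crosses exactly one of these sides.
  The next three lemmas are rotations of this one; for the corners \<open>q\<close> and
  \<open>r\<close> the end \<open>y\<close> lies on the arc from \<open>s\<close> round to
  \<open>p\<close>, which the numbering splits.\<close>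

lemma quad_fan_p:
  fixes p q r s a b x y :: nat
  assumes "p < q" "q < r" "r < s" "a < b" "(a, b) \<noteq> (p, r)"
    and "q < x" "x < r" "r < y" "y < s" "\<not> crosses (p, x) (a, b)" "\<not> crosses (p, y) (a, b)"
  shows "2 * crossing (p, r) (a, b) + crossing (q, s) (a, b) =
    crossing (q, r) (a, b) + crossing (r, s) (a, b)"
  by (rule quad_position[OF assms(1-3), of a]; rule quad_position[OF assms(1-3), of b];
      use assms in \<open>simp add: crossing_def crosses_def\<close>)

lemma quad_fan_q:
  fixes p q r s a b x y :: nat
  assumes "p < q" "q < r" "r < s" "a < b" "(a, b) \<noteq> (q, s)"
    and "r < x" "x < s" "\<not> crosses (q, x) (a, b)" "s < y \<and> \<not> crosses (q, y) (a, b) \<or> y < p \<and> \<not> crosses (y, q) (a, b)"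
  shows "2 * crossing (q, s) (a, b) + crossing (p, r) (a, b) =
    crossing (r, s) (a, b) + crossing (p, s) (a, b)"
  using assms(9)
  by - (elim disjE conjE; rule quad_position[OF assms(1-3), of a]; rule quad_position[OF assms(1-3), of b];
      use assms(1-8) in \<open>simp add: crossing_def crosses_def\<close>)

lemma quad_fan_r:
  fixes p q r s a b x y :: nat
  assumes "p < q" "q < r" "r < s" "a < b" "(a, b) \<noteq> (p, r)"
    and "p < x" "x < q" "\<not> crosses (x, r) (a, b)" "s < y \<and> \<not> crosses (r, y) (a, b) \<or> y < p \<and> \<not> crosses (y, r) (a, b)"
  shows "2 * crossing (p, r) (a, b) + crossing (q, s) (a, b) =
    crossing (p, s) (a, b) + crossing (p, q) (a, b)"
  using assms(9)
  by - (elim disjE conjE; rule quad_position[OF assms(1-3), of a]; rule quad_position[OF assms(1-3), of b];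
      use assms(1-8) in \<open>simp add: crossing_def crosses_def\<close>)

lemma quad_fan_s:
  fixes p q r s a b x y :: nat
  assumes "p < q" "q < r" "r < s" "a < b" "(a, b) \<noteq> (q, s)"
    and "p < x" "x < q" "q < y" "y < r" "\<not> crosses (x, s) (a, b)" "\<not> crosses (y, s) (a, b)"
  shows "2 * crossing (q, s) (a, b) + crossing (p, r) (a, b) =
    crossing (p, q) (a, b) + crossing (q, r) (a, b)"
  by (rule quad_position[OF assms(1-3), of a]; rule quad_position[OF assms(1-3), of b];
      use assms in \<open>simp add: crossing_def crosses_def\<close>)

section \<open>Heights of chords and the straightening relation\<close>

definition chord_length :: "nat \<times> nat \<Rightarrow> real" where
  "chord_length c = real (snd c) - real (fst c)"

text \<open>Concave in the length and unchanged when \<open>l\<close> becomes \<open>N - l\<close>,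
  as can happen under the half turn of the cycle model.\<close>

definition chord_height :: "nat \<Rightarrow> nat \<times> nat \<Rightarrow> real" where
  "chord_height N c = chord_length c * (real N - chord_length c)"

definition coord :: "(nat \<times> nat) set \<Rightarrow> nat \<times> nat \<Rightarrow> nat \<times> nat \<Rightarrow> real" where
  "coord I T c = (if T \<in> I then - of_bool (c = T) else crossing T c)"

definition height :: "nat \<Rightarrow> (nat \<times> nat) set \<Rightarrow> nat \<times> nat \<Rightarrow> real" where
  "height N I T = (if T \<in> I then 2 * real N ^ 2 + 1 else chord_height N T)"

lemma chord_height_bounds:
  assumes "fst c < snd c" "snd c \<le> N"
  shows "0 \<le> chord_height N c" "chord_height N c \<le> real N ^ 2"
proof -
  have "0 \<le> chord_length c" "chord_length c \<le> real N" using assms by (auto simp: chord_length_def)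
  then show "0 \<le> chord_height N c" "chord_height N c \<le> real N ^ 2"
    unfolding chord_height_def power2_eq_square by (auto intro!: mult_mono mult_nonneg_nonneg)
qed

text \<open>In terms of the gaps \<open>a, b, c, d\<close> between consecutive corners, right minus
  left is a positive combination of products of gaps; for the first two it is
  \<open>2 * b * d\<close> and \<open>2 * a * c\<close>.\<close>

lemma quad_heights:
  fixes p q r s N :: nat
  assumes "p < q" "q < r" "r < s" "s < N"
  defines "f \<equiv> chord_height N"
  shows "f (p, q) + f (r, s) < f (p, r) + f (q, s)"
    and "f (q, r) + f (p, s) < f (p, r) + f (q, s)"
    and "f (q, r) + f (r, s) < 2 * f (p, r) + f (q, s)"
    and "f (p, s) + f (p, q) < 2 * f (p, r) + f (q, s)"
    and "f (r, s) + f (p, s) < f (p, r) + 2 * f (q, s)"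
    and "f (p, q) + f (q, r) < f (p, r) + 2 * f (q, s)"
proof -
  define a b c d where "a = real q - real p" and "b = real r - real q"
    and "c = real s - real r" and "d = real N - (real s - real p)"
  have pos: "a > 0" "b > 0" "c > 0" "d > 0" using assms by (auto simp: a_def b_def c_def d_def)
  have f: "f (p, q) = a * (b + c + d)" "f (q, r) = b * (a + c + d)" "f (r, s) = c * (a + b + d)"
    "f (p, s) = (a + b + c) * d" "f (p, r) = (a + b) * (c + d)" "f (q, s) = (b + c) * (a + d)"
    unfolding f_def chord_height_def chord_length_def fst_conv snd_conv a_def b_def c_def d_def
    by simp_all
  have prods: "a * b > 0" "a * c > 0" "a * d > 0" "b * c > 0" "b * d > 0" "c * d > 0"
    using pos by simp_all
  show "f (p, q) + f (r, s) < f (p, r) + f (q, s)"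
    "f (q, r) + f (p, s) < f (p, r) + f (q, s)"
    "f (q, r) + f (r, s) < 2 * f (p, r) + f (q, s)"
    "f (p, s) + f (p, q) < 2 * f (p, r) + f (q, s)"
    "f (r, s) + f (p, s) < f (p, r) + 2 * f (q, s)"
    "f (p, q) + f (q, r) < f (p, r) + 2 * f (q, s)"
    unfolding f using prods by (simp_all add: algebra_simps)
qed

text \<open>The right side uses \<open>crossing\<close> and \<open>chord_height\<close>, not
  \<open>coord\<close> and \<open>height\<close>: an initial side has zero crossings on
  \<open>I\<close> and is to be dropped, not replaced by its negative generator.\<close>

lemma quad_relation:
  fixes p q r s N :: nat
  assumes I: "\<And>c d. c \<in> I \<Longrightarrow> d \<in> I \<Longrightarrow> \<not> crosses c d" "\<And>c. c \<in> I \<Longrightarrow> fst c < snd c"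
    and ord: "p < q" "q < r" "r < s" "s < N"
  shows "\<exists>\<alpha> \<beta> S S'. 0 \<le> \<alpha> \<and> 0 \<le> \<beta> \<and> {S, S'} \<subseteq> {(p, q), (q, r), (r, s), (p, s)} \<and>
    (\<forall>c\<in>I. \<alpha> * coord I (p, r) c + \<beta> * coord I (q, s) c = crossing S c + crossing S' c) \<and>
    chord_height N S + chord_height N S' < \<alpha> * height N I (p, r) + \<beta> * height N I (q, s)"
proof -
  let ?T = "(p, r)" and ?U = "(q, s)"
  let ?R = "{(p, q), (q, r), (r, s), (p, s)}"
  note o3 = ord(1-3)
  have TU: "crosses ?T ?U" "crosses ?U ?T" using ord by (auto simp: crosses_def)
  then have not_both: "?T \<notin> I \<or> ?U \<notin> I" using I(1) by blast
  \<comment> \<open>An initial diagonal alone outweighs any two sides; with no initial diagonal the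
    comparison is one from \<open>quad_heights\<close>.\<close>
  have ht: "chord_height N S + chord_height N S' < \<alpha> * height N I ?T + \<beta> * height N I ?U"
    if S: "S \<in> ?R" "S' \<in> ?R" and ab: "1 \<le> \<alpha>" "1 \<le> \<beta>"
      and free: "?T \<notin> I \<Longrightarrow> ?U \<notin> I \<Longrightarrow>
        chord_height N S + chord_height N S' < \<alpha> * chord_height N ?T + \<beta> * chord_height N ?U"
    for S S' \<alpha> \<beta>
  proof -
    have "chord_height N S \<le> real N ^ 2" "chord_height N S' \<le> real N ^ 2"
      using S ord by (auto intro!: chord_height_bounds(2))
    then have RHS: "chord_height N S + chord_height N S' < 2 * real N ^ 2 + 1" by simp
    have nn: "0 \<le> chord_height N ?T" "0 \<le> chord_height N ?U"
      using ord by (auto intro!: chord_height_bounds(1))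
    have big: "2 * real N ^ 2 + 1 \<le> x * (2 * real N ^ 2 + 1)" if "1 \<le> x" for x
    proof -
      have "0 \<le> 2 * real N ^ 2 + 1" by simp
      from mult_right_mono[OF that this] show ?thesis by simp
    qed
    consider "?T \<in> I" "?U \<notin> I" | "?T \<notin> I" "?U \<in> I" | "?T \<notin> I" "?U \<notin> I" using not_both by blast
    then show ?thesis
    proof cases
      case 1
      have "0 \<le> \<beta> * chord_height N ?U" using ab nn by simp
      then show ?thesis using 1 RHS big[OF ab(1)] by (simp add: height_def)
    next
      case 2
      have "0 \<le> \<alpha> * chord_height N ?T" using ab nn by simp
      then show ?thesis using 2 RHS big[OF ab(2)] by (simp add: height_def)
    next
      case 3
      then show ?thesis using free by (simp add: height_def)
    qed
  qed
  \<comment> \<open>At an initial diagonal its own entry -1 cancels the crossing 1 of the other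
    diagonal, and no side crosses it.\<close>
  have at_TU: "coord I ?T c + coord I ?U c = 0 \<and> (\<forall>S\<in>?R. crossing S c = 0)"
    if c: "c \<in> I" "c = ?T \<or> c = ?U" for c
  proof -
    have "\<forall>S\<in>?R. crossing S c = 0" 
    proof (rule disjE[OF c(2)])
      show "\<forall>S\<in>?R. crossing S c = 0" if "c = ?T"
        unfolding that crossing_def crosses_def using ord by simp
      show "\<forall>S\<in>?R. crossing S c = 0" if "c = ?U"
        unfolding that crossing_def crosses_def using ord by simp
    qed
    moreover have "coord I ?T c + coord I ?U c = 0"
      using c not_both TU by (auto simp: coord_def crossing_def)
    ultimately show ?thesis by blast
  qed
  have cr0: "crossing S c = 0" if "S \<in> I" "c \<in> I" for S c
    using that I(1) by (simp add: crossing_def)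
  have co: "coord I S c = crossing S c" if "c \<in> I" "c \<noteq> S" for S c
    using that cr0 by (simp add: coord_def)
  define A where "A c \<longleftrightarrow> crossing ?T c + crossing ?U c = crossing (p, q) c + crossing (r, s) c" for c
  define B where "B c \<longleftrightarrow> crossing ?T c + crossing ?U c = crossing (q, r) c + crossing (p, s) c" for c
  let ?J = "I - {?T, ?U}"
  have pairs: "\<exists>a b. c = (a, b) \<and> a < b" if "c \<in> I" for c
    using I(2)[OF that] by (cases c) simp
  have fan: ?thesis
    if X: "(X = ?T \<and> Y = ?U) \<or> (X = ?U \<and> Y = ?T)" and Y: "Y \<notin> I"
      and S: "S \<in> ?R" "S' \<in> ?R"
      and rel: "\<And>c. c \<in> I \<Longrightarrow> c \<noteq> X \<Longrightarrow> 2 * crossing X c + crossing Y c = crossing S c + crossing S' c"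
      and hts: "chord_height N S + chord_height N S' < 2 * chord_height N X + chord_height N Y"
    for X Y S S'
  proof -
    \<comment> \<open>For initial \<open>X\<close> the coefficient 2 would leave -2 + 1 at the
      coordinate \<open>X\<close>. Coefficient 1 is right there, and at the rest of \<open>I\<close>
      the crossings of \<open>X\<close> vanish anyway.\<close>
    define k :: real where "k = (if X \<in> I then 1 else 2)"
    have kX: "k * crossing X c = 2 * crossing X c" if "c \<in> I" for c
      using cr0[of X c] that by (simp add: k_def)
    have eq: "k * coord I X c + coord I Y c = crossing S c + crossing S' c" if c: "c \<in> I" for c
    proof (cases "c = X")
      case True
      then show ?thesis using at_TU[OF c] X S c by (auto simp: k_def)
    next
      case False
      have "coord I Y c = crossing Y c" using Y by (simp add: coord_def)
      then show ?thesis using rel[OF c False] co[OF c False] kX[OF c] by (simp only:)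
    qed
    have k: "1 \<le> k" "X \<notin> I \<Longrightarrow> k = 2" by (auto simp: k_def)
    show ?thesis
    proof (cases "X = ?T")
      case True
      then have Y': "Y = ?U" using X ord by auto
      have "chord_height N S + chord_height N S' < k * height N I ?T + 1 * height N I ?U"
        using k hts True Y' by (intro ht S) auto
      then show ?thesis using eq S True Y' k(1)
        by (intro exI[of _ k] exI[of _ 1] exI[of _ S] exI[of _ S']) auto
    next
      case False
      then have XY: "X = ?U" "Y = ?T" using X by auto
      have "chord_height N S + chord_height N S' < 1 * height N I ?T + k * height N I ?U"
        using k hts XY by (intro ht S) auto
      then show ?thesis using eq S XY k(1)
        by (intro exI[of _ 1] exI[of _ k] exI[of _ S] exI[of _ S']) (auto simp: add.commute)
    qed
  qed
  consider (A) "\<forall>c\<in>?J. A c" | (B) "\<forall>c\<in>?J. B c"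
    | (AB) c d where "c \<in> ?J" "d \<in> ?J" "\<not> A c" "\<not> B d" by blast
  then show ?thesis
  proof cases
    case A
    have "coord I ?T c + coord I ?U c = crossing (p, q) c + crossing (r, s) c" if "c \<in> I" for c
      using A at_TU[OF that] co[OF that] that by (cases "c = ?T \<or> c = ?U") (auto simp: A_def)
    then show ?thesis using ht[of "(p, q)" "(r, s)" 1 1] quad_heights(1)[OF ord]
      by (intro exI[of _ 1] exI[of _ "(p, q)"] exI[of _ "(r, s)"]) auto
  next
    case B
    have "coord I ?T c + coord I ?U c = crossing (q, r) c + crossing (p, s) c" if "c \<in> I" for c
      using B at_TU[OF that] co[OF that] that by (cases "c = ?T \<or> c = ?U") (auto simp: B_def)
    then show ?thesis using ht[of "(q, r)" "(p, s)" 1 1] quad_heights(2)[OF ord]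
      by (intro exI[of _ 1] exI[of _ "(q, r)"] exI[of _ "(p, s)"]) auto
  next
    case AB
    obtain a b where ab: "c = (a, b)" "a < b" using pairs AB(1) by blast
    obtain a' b' where ab': "d = (a', b')" "a' < b'" using pairs AB(2) by blast
    have cA: "a = p \<and> q < b \<and> b < r \<or> q < a \<and> a < r \<and> b = s \<or>
        a < p \<and> q \<le> b \<and> b \<le> r \<or> q \<le> a \<and> a \<le> r \<and> s < b"
      using AB(1,3) ab by (intro quad_sides_A[OF o3]) (auto simp: A_def)
    have dB: "a' = p \<and> r < b' \<and> b' < s \<or> p < a' \<and> a' < q \<and> r \<le> b' \<and> b' \<le> s
        \<or> a' = q \<and> r < b' \<and> b' < s"
      using AB(2,4) ab' by (intro quad_sides_B[OF o3]) (auto simp: B_def)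
    \<comment> \<open>One chord joins the arcs \<open>qr\<close> and \<open>sp\<close>, the other
      the arcs \<open>pq\<close> and \<open>rs\<close>. Without crossing they must share an end,
      which is one of the four corners.\<close>
    have "\<not> crosses (a, b) (a', b')" using AB I(1) ab ab' by auto
    then have "(a = p \<and> q < b \<and> b < r) \<and> (a' = p \<and> r < b' \<and> b' < s)
      \<or> (q < a \<and> a < r \<and> b = s) \<and> (p < a' \<and> a' < q \<and> b' = s)
      \<or> (a < p \<and> b = q \<or> a = q \<and> s < b) \<and> (a' = q \<and> r < b' \<and> b' < s)
      \<or> (a < p \<and> b = r \<or> a = r \<and> s < b) \<and> (p < a' \<and> a' < q \<and> b' = r)"
      using cA dB ord ab(2) ab'(2) unfolding crosses_def fst_conv snd_conv
      by - (elim disjE; auto)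
    moreover have cI: "c \<in> I" and dI: "d \<in> I" using AB by auto
    have no: "\<not> crosses c e" "\<not> crosses d e" if "e \<in> I" for e using that cI dI I(1) by auto
    have free: "X \<notin> I" if "crosses c X" for X using that cI I(1) by blast
    have heights: "chord_height N (q, r) + chord_height N (r, s) < 2 * chord_height N ?T + chord_height N ?U"
      "chord_height N (p, s) + chord_height N (p, q) < 2 * chord_height N ?T + chord_height N ?U"
      "chord_height N (r, s) + chord_height N (p, s) < 2 * chord_height N ?U + chord_height N ?T"
      "chord_height N (p, q) + chord_height N (q, r) < 2 * chord_height N ?U + chord_height N ?T"
      using quad_heights[OF ord] by simp_all
    ultimately show ?thesis
    proof (elim disjE)
      assume h: "(a = p \<and> q < b \<and> b < r) \<and> (a' = p \<and> r < b' \<and> b' < s)"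
      have "?U \<notin> I" using free h ab ord by (auto simp: crosses_def)
      moreover have "2 * crossing ?T e + crossing ?U e = crossing (q, r) e + crossing (r, s) e"
        if e: "e \<in> I" "e \<noteq> ?T" for e
      proof -
        obtain x y where xy: "e = (x, y)" "x < y" using pairs e(1) by blast
        show ?thesis unfolding xy(1)
          by (rule quad_fan_p[OF o3 xy(2), of b b']) (use h e no[OF e(1)] xy ab ab' in auto)
      qed
      ultimately show ?thesis using heights(1) by (intro fan[of ?T ?U]) auto
    next
      assume h: "(q < a \<and> a < r \<and> b = s) \<and> (p < a' \<and> a' < q \<and> b' = s)"
      have "?T \<notin> I" using free h ab ord by (auto simp: crosses_def)
      moreover have "2 * crossing ?U e + crossing ?T e = crossing (p, q) e + crossing (q, r) e"
        if e: "e \<in> I" "e \<noteq> ?U" for e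
      proof -
        obtain x y where xy: "e = (x, y)" "x < y" using pairs e(1) by blast
        show ?thesis unfolding xy(1)
          by (rule quad_fan_s[OF o3 xy(2), of a' a]) (use h e no[OF e(1)] xy ab ab' in auto)
      qed
      ultimately show ?thesis using heights(4) by (intro fan[of ?U ?T]) auto
    next
      assume h: "(a < p \<and> b = q \<or> a = q \<and> s < b) \<and> (a' = q \<and> r < b' \<and> b' < s)"
      have "?T \<notin> I" using free h ab ord by (auto simp: crosses_def)
      moreover have "2 * crossing ?U e + crossing ?T e = crossing (r, s) e + crossing (p, s) e"
        if e: "e \<in> I" "e \<noteq> ?U" for e
      proof -
        obtain x y where xy: "e = (x, y)" "x < y" using pairs e(1) by blast
        show ?thesis unfolding xy(1)
          by (rule quad_fan_q[OF o3 xy(2), of b' "if b = q then a else b"])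
            (use h e no[OF e(1)] xy ab ab' ord in auto)
      qed
      ultimately show ?thesis using heights(3) by (intro fan[of ?U ?T]) auto
    next
      assume h: "(a < p \<and> b = r \<or> a = r \<and> s < b) \<and> (p < a' \<and> a' < q \<and> b' = r)"
      have "?U \<notin> I" using free h ab ord by (auto simp: crosses_def)
      moreover have "2 * crossing ?T e + crossing ?U e = crossing (p, s) e + crossing (p, q) e"
        if e: "e \<in> I" "e \<noteq> ?T" for e
      proof -
        obtain x y where xy: "e = (x, y)" "x < y" using pairs e(1) by blast
        show ?thesis unfolding xy(1)
          by (rule quad_fan_r[OF o3 xy(2), of a' "if b = r then a else b"])
            (use h e no[OF e(1)] xy ab ab' ord in auto)
      qed
      ultimately show ?thesis using heights(2) by (intro fan[of ?T ?U]) auto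
    qed
  qed
qed

section \<open>Compatibility degrees as crossing numbers\<close>

text \<open>Tubes correspond to orbits of chords of an \<open>N\<close>-gon under the involution \<open>rot\<close>; \<open>chord T\<close> is
  a representative of the orbit of \<open>T\<close>. An orbit with one element is counted twice.\<close>

locale chord_model = connected_pair_graph G for G :: "'v pair_pre_digraph" +
  fixes N :: nat and rot :: "nat \<times> nat \<Rightarrow> nat \<times> nat" and chord :: "'v set \<Rightarrow> nat \<times> nat"
    and valid :: "nat \<times> nat \<Rightarrow> bool"
  defines "valid c \<equiv> fst c < snd c \<and> snd c < N"
  assumes chord_valid: "proper_tube G T \<Longrightarrow> valid (chord T)"
    and rot_valid: "valid c \<Longrightarrow> valid (rot c)"
    and rot_rot: "valid c \<Longrightarrow> rot (rot c) = c"
    and rot_crosses: "valid c \<Longrightarrow> valid d \<Longrightarrow> crosses (rot c) (rot d) \<longleftrightarrow> crosses c d"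
    and rot_height: "valid c \<Longrightarrow> chord_height N (rot c) = chord_height N c"
    and no_self_crossing: "valid c \<Longrightarrow> \<not> crosses c (rot c)"
    and chord_surj: "valid c \<Longrightarrow> valid d \<Longrightarrow> crosses c d \<Longrightarrow>
      \<exists>T. proper_tube G T \<and> (chord T = c \<or> chord T = rot c)"
    and chord_inj: "proper_tube G T \<Longrightarrow> proper_tube G U \<Longrightarrow>
      chord T = chord U \<or> chord T = rot (chord U) \<Longrightarrow> T = U"
    and degree_crossing: "proper_tube G T \<Longrightarrow> proper_tube G U \<Longrightarrow> T \<noteq> U \<Longrightarrow>
      (if rot (chord T) = chord T then 2 else 1) * real_of_int (compatibility_degree G T U) =
      crossing (chord T) (chord U) + crossing (chord T) (rot (chord U))"
begin

definition weight :: "'v set \<Rightarrow> real" where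
  "weight T = (if rot (chord T) = chord T then 2 else 1)"

lemma weight_pos: "weight T > 0"
  by (simp add: weight_def)

text \<open>Makes the right side of \<open>degree_crossing\<close> symmetric in \<open>T\<close> and
  \<open>U\<close>, so the degree and its dual differ by the factors \<open>weight\<close>
  alone.\<close>

lemma crosses_rot_left: "valid c \<Longrightarrow> valid d \<Longrightarrow> crosses (rot c) d \<longleftrightarrow> crosses c (rot d)"
  using rot_crosses[of c "rot d"] rot_valid rot_rot by simp

end

locale initial_tubing = chord_model +
  fixes T0 :: "'i::finite \<Rightarrow> 'a set"
  assumes inj_T0: "inj T0"
    and maximal_T0: "maximal_tubing G (range T0)"
begin

section \<open>Crossing coordinates of tubes relative to the initial tubing\<close>

definition K :: "'a set set" where
  "K = {T. proper_tube G T}"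

definition I :: "(nat \<times> nat) set" where
  "I = (\<Union>i. {chord (T0 i), rot (chord (T0 i))})"

definition orbit_coord :: "nat \<times> nat \<Rightarrow> 'i \<Rightarrow> real" where
  "orbit_coord c i = coord I c (chord (T0 i)) + coord I c (rot (chord (T0 i)))"

lemma tubing_T0: "tubing G (range T0)"
  using maximal_T0 by (simp add: maximal_tubing_def)

lemma proper_T0: "proper_tube G (T0 i)"
  using tubing_T0 by (simp add: tubing_def)

lemma compatible_T0: "tubes_compatible G (T0 i) (T0 j)"
  using tubing_T0 by (simp add: tubing_def)

lemma finite_K: "finite K"
  by (rule finite_subset[of _ "Pow V"]) (use finite_V tube_subset in \<open>auto simp: K_def proper_tube_iff\<close>)

lemma valid_T0: "valid (chord (T0 i))" "valid (rot (chord (T0 i)))"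
  using chord_valid[OF proper_T0] rot_valid by auto

lemma chord_T0_in_I: "chord (T0 i) \<in> I" "rot (chord (T0 i)) \<in> I"
  by (auto simp: I_def)

lemma I_valid: "c \<in> I \<Longrightarrow> valid c"
  using valid_T0 by (auto simp: I_def)

lemma I_rot: "valid c \<Longrightarrow> rot c \<in> I \<longleftrightarrow> c \<in> I"
proof -
  have "rot d \<in> I" if "d \<in> I" for d
    using that rot_rot[OF valid_T0(1)] by (auto simp: I_def)
  then show "valid c \<Longrightarrow> rot c \<in> I \<longleftrightarrow> c \<in> I" using rot_rot by metis
qed

lemma degree_T0: "i \<noteq> j \<Longrightarrow> compatibility_degree G (T0 i) (T0 j) = 0"
  using compatibility_degree_zero[of "T0 i" "T0 j"] proper_T0 compatible_T0 inj_T0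
  by (auto simp: proper_tube_iff inj_eq)

lemma I_no_crossing:
  assumes "c \<in> I" "d \<in> I" shows "\<not> crosses c d"
proof -
  have base: "\<not> crosses (chord (T0 i)) (chord (T0 j)) \<and> \<not> crosses (chord (T0 i)) (rot (chord (T0 j)))" for i j
  proof (cases "i = j")
    case True
    then show ?thesis using no_self_crossing valid_T0(1) by (simp add: crosses_def)
  next
    case False
    then have "T0 i \<noteq> T0 j" using inj_T0 by (simp add: inj_eq)
    from degree_crossing[OF proper_T0 proper_T0 this] degree_T0[OF False]
    show ?thesis by (auto simp: crossing_def of_bool_def split: if_splits)
  qed
  obtain i j where "c = chord (T0 i) \<or> c = rot (chord (T0 i))" "d = chord (T0 j) \<or> d = rot (chord (T0 j))"
    using assms by (auto simp: I_def)
  then show ?thesis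
    using base[of i j] crosses_rot_left[OF valid_T0(1) valid_T0(1), of i j]
      rot_crosses[OF valid_T0(1) valid_T0(1), of i j] by blast
qed

lemma crossing_rot: "valid c \<Longrightarrow> valid d \<Longrightarrow> crossing (rot c) d = crossing c (rot d)"
  by (simp add: crossing_def crosses_rot_left)

lemma coord_rot:
  assumes "valid c" "valid d" shows "coord I (rot c) d = coord I c (rot d)"
proof -
  have "d = rot c \<longleftrightarrow> rot d = c" using assms rot_rot by metis
  then show ?thesis using assms I_rot crossing_rot by (simp add: coord_def)
qed

lemma orbit_coord_rot: "valid c \<Longrightarrow> orbit_coord (rot c) i = orbit_coord c i"
  using coord_rot[of c] valid_T0[of i] rot_rot by (simp add: orbit_coord_def)

lemma chord_in_I:
  assumes T: "proper_tube G T" shows "chord T \<in> I \<longleftrightarrow> T \<in> range T0"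
  using chord_inj[OF T proper_T0] by (auto simp: I_def)

text \<open>If \<open>rot\<close> fixes the chord, both summands of \<open>orbit_coord\<close> are
  -1; otherwise only one is.\<close>

lemma orbit_coord_T0: "orbit_coord (chord (T0 j)) i = (if i = j then - weight (T0 j) else 0)"
proof (cases "i = j")
  case True
  then show ?thesis by (auto simp: orbit_coord_def coord_def weight_def I_def)
next
  case False
  then have "T0 j \<noteq> T0 i" using inj_T0 by (simp add: inj_eq)
  then have "chord (T0 j) \<noteq> chord (T0 i)" "chord (T0 j) \<noteq> rot (chord (T0 i))"
    using chord_inj[OF proper_T0 proper_T0] by blast+
  then show ?thesis using False by (auto simp: orbit_coord_def coord_def I_def)
qed

text \<open>Here the factor depends on the generator \<open>T\<close>, in
  \<open>orbit_coord_primal\<close> on the coordinate \<open>i\<close>; this decides which rescaling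
  each fan receives.\<close>

lemma orbit_coord_dual:
  assumes T: "proper_tube G T"
  shows "orbit_coord (chord T) i = weight T * compatibility_degree G T (T0 i)"
proof (cases "T \<in> range T0")
  case True
  then obtain j where j: "T = T0 j" by blast
  show ?thesis unfolding j orbit_coord_T0
    using degree_T0[of j i] by (auto simp: compatibility_degree_def)
next
  case False
  then have "T \<noteq> T0 i" by blast
  then show ?thesis
    using degree_crossing[OF T proper_T0, of i] False chord_in_I[OF T]
    by (simp add: orbit_coord_def coord_def weight_def)
qed

lemma orbit_coord_primal:
  assumes T: "proper_tube G T"
  shows "orbit_coord (chord T) i = weight (T0 i) * compatibility_degree G (T0 i) T"
proof (cases "T \<in> range T0")
  case True
  then obtain j where j: "T = T0 j" by blast
  show ?thesis unfolding j orbit_coord_T0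
    using degree_T0[of i j] by (auto simp: compatibility_degree_def)
next
  case False
  then have "T0 i \<noteq> T" by blast
  from degree_crossing[OF proper_T0 T this]
  have "weight (T0 i) * compatibility_degree G (T0 i) T =
    crossing (chord T) (chord (T0 i)) + crossing (rot (chord T)) (chord (T0 i))"
    by (simp add: weight_def crossing_def crosses_sym)
  then show ?thesis
    using False chord_in_I[OF T] crossing_rot[OF chord_valid[OF T] valid_T0(1)]
    by (simp add: orbit_coord_def coord_def)
qed

lemma orbit_coord_nonneg:
  assumes "proper_tube G T" "T \<notin> range T0" shows "orbit_coord (chord T) i \<ge> 0"
  using assms chord_in_I by (simp add: orbit_coord_def coord_def crossing_def)

definition tube_height :: "'a set \<Rightarrow> real" where
  "tube_height T = height N I (chord T)"

lemma tube_height_T0: "tube_height (T0 i) = 2 * real N ^ 2 + 1"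
  by (simp add: tube_height_def height_def chord_T0_in_I)

lemma tube_height_pos:
  assumes "proper_tube G T" "T \<notin> range T0" shows "tube_height T > 0"
  using assms chord_in_I chord_valid[OF assms(1)]
  by (auto simp: tube_height_def height_def chord_height_def chord_length_def valid_def
      intro!: mult_pos_pos)

text \<open>A side that is not initial but crosses something belongs to a tube. An initial side or
  an edge of the polygon crosses no chord of \<open>I\<close>, so the zero combination expands it,
  at no more than its nonnegative height.\<close>

lemma side_expansion:
  assumes S: "valid S"
  shows "\<exists>a. (\<forall>T\<in>K. 0 \<le> a T) \<and>
    (\<forall>i. (\<Sum>T\<in>K. a T * orbit_coord (chord T) i) = crossing S (chord (T0 i)) + crossing S (rot (chord (T0 i)))) \<and>
    (\<Sum>T\<in>K. a T * tube_height T) \<le> chord_height N S"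
proof (cases "S \<notin> I \<and> (\<exists>d. valid d \<and> crosses S d)")
  case True
  then obtain T where T: "proper_tube G T" "chord T = S \<or> chord T = rot S"
    using chord_surj[OF S] by blast
  have TI: "chord T \<notin> I" using T(2) True I_rot[OF S] by auto
  have z: "orbit_coord (chord T) i = orbit_coord S i" for i
    using T(2) orbit_coord_rot[OF S] by auto
  have "T \<in> K" using T by (simp add: K_def)
  then have sum: "(\<Sum>U\<in>K. of_bool (U = T) * f U) = f T" for f :: "'a set \<Rightarrow> real"
    using finite_K by (simp add: of_bool_def if_distrib[of "\<lambda>x. x * _"] sum.delta cong: if_cong)
  have "tube_height T = chord_height N S"
    using TI T(2) rot_height[OF S] by (auto simp: tube_height_def height_def)
  then show ?thesis
    using True z by (intro exI[of _ "\<lambda>U. of_bool (U = T)"]) (auto simp: sum orbit_coord_def coord_def)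
next
  case False
  have "\<not> crosses S c" if "c \<in> I" for c
    using False that I_no_crossing I_valid by blast
  then have "crossing S c = 0" if "c \<in> I" for c
    using that by (simp add: crossing_def)
  moreover have "0 \<le> chord_height N S"
    using S by (intro chord_height_bounds) (auto simp: valid_def)
  ultimately show ?thesis by (intro exI[of _ "\<lambda>_. 0"]) (simp add: chord_T0_in_I)
qed

text \<open>Resolving this one crossing is enough, without its image under \<open>rot\<close>:
  \<open>I\<close> is stable under \<open>rot\<close>, and adding the entries of the chord relation
  at \<open>chord (T0 i)\<close> and its image gives orbit coordinates.\<close>

lemma straighten_crossing:
  assumes c: "valid c" and d: "valid d" and "crosses c d"
  shows "\<exists>\<alpha> \<beta> a. 0 \<le> \<alpha> \<and> 0 \<le> \<beta> \<and> (\<forall>S\<in>K. 0 \<le> a S) \<and>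
    (\<forall>i. \<alpha> * orbit_coord c i + \<beta> * orbit_coord d i = (\<Sum>S\<in>K. a S * orbit_coord (chord S) i)) \<and>
    (\<Sum>S\<in>K. a S * tube_height S) < \<alpha> * height N I c + \<beta> * height N I d"
proof -
  have main: "\<exists>\<alpha> \<beta> a. 0 \<le> \<alpha> \<and> 0 \<le> \<beta> \<and> (\<forall>S\<in>K. 0 \<le> a S) \<and>
    (\<forall>i. \<alpha> * orbit_coord (p, r) i + \<beta> * orbit_coord (q, s) i = (\<Sum>S\<in>K. a S * orbit_coord (chord S) i)) \<and>
    (\<Sum>S\<in>K. a S * tube_height S) < \<alpha> * height N I (p, r) + \<beta> * height N I (q, s)"
    if ord: "p < q" "q < r" "r < s" "s < N" for p q r s
  proof -
    have lt: "fst e < snd e" if "e \<in> I" for e using I_valid[OF that] by (simp add: valid_def)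
    have "\<exists>\<alpha> \<beta> S S'. 0 \<le> \<alpha> \<and> 0 \<le> \<beta> \<and> {S, S'} \<subseteq> {(p, q), (q, r), (r, s), (p, s)} \<and>
      (\<forall>e\<in>I. \<alpha> * coord I (p, r) e + \<beta> * coord I (q, s) e = crossing S e + crossing S' e) \<and>
      chord_height N S + chord_height N S' < \<alpha> * height N I (p, r) + \<beta> * height N I (q, s)"
      by (rule quad_relation[OF _ _ ord]) (use I_no_crossing lt in blast)+
    then obtain \<alpha> \<beta> S S' where rel: "0 \<le> \<alpha>" "0 \<le> \<beta>" "{S, S'} \<subseteq> {(p, q), (q, r), (r, s), (p, s)}"
      "\<forall>e\<in>I. \<alpha> * coord I (p, r) e + \<beta> * coord I (q, s) e = crossing S e + crossing S' e"
      "chord_height N S + chord_height N S' < \<alpha> * height N I (p, r) + \<beta> * height N I (q, s)"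
      by blast
    have S: "valid S" "valid S'" using rel(3) ord by (auto simp: valid_def)
    obtain a where a: "\<forall>T\<in>K. 0 \<le> a T"
      "\<forall>i. (\<Sum>T\<in>K. a T * orbit_coord (chord T) i) = crossing S (chord (T0 i)) + crossing S (rot (chord (T0 i)))"
      "(\<Sum>T\<in>K. a T * tube_height T) \<le> chord_height N S"
      using side_expansion[OF S(1)] by blast
    obtain a' where a': "\<forall>T\<in>K. 0 \<le> a' T"
      "\<forall>i. (\<Sum>T\<in>K. a' T * orbit_coord (chord T) i) = crossing S' (chord (T0 i)) + crossing S' (rot (chord (T0 i)))"
      "(\<Sum>T\<in>K. a' T * tube_height T) \<le> chord_height N S'"
      using side_expansion[OF S(2)] by blast
    have "\<alpha> * orbit_coord (p, r) i + \<beta> * orbit_coord (q, s) i =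
        (\<Sum>T\<in>K. (a T + a' T) * orbit_coord (chord T) i)" for i
    proof -
      have "chord (T0 i) \<in> I" "rot (chord (T0 i)) \<in> I" by (auto simp: I_def)
      from rel(4)[rule_format, OF this(1)] rel(4)[rule_format, OF this(2)] show ?thesis
        using a(2)[rule_format, of i] a'(2)[rule_format, of i]
        by (simp add: orbit_coord_def distrib_right sum.distrib distrib_left)
    qed
    moreover have "(\<Sum>T\<in>K. (a T + a' T) * tube_height T) < \<alpha> * height N I (p, r) + \<beta> * height N I (q, s)"
      using a(3) a'(3) rel(5) by (simp add: distrib_right sum.distrib)
    ultimately show ?thesis using a(1) a'(1) rel(1,2)
      by (intro exI[of _ \<alpha>] exI[of _ \<beta>] exI[of _ "\<lambda>T. a T + a' T"]) auto
  qed
  have cd: "c = (fst c, snd c)" "d = (fst d, snd d)" by simp_all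
  consider "fst c < fst d" "fst d < snd c" "snd c < snd d" | "fst d < fst c" "fst c < snd d" "snd d < snd c"
    using assms(3) by (auto simp: crosses_def)
  then show ?thesis
  proof cases
    case 1
    then show ?thesis using main[of "fst c" "fst d" "snd c" "snd d"] d by (simp add: valid_def)
  next
    case 2
    then obtain \<alpha> \<beta> a where *: "0 \<le> \<alpha>" "0 \<le> \<beta>" "\<forall>S\<in>K. 0 \<le> a S"
      "\<forall>i. \<alpha> * orbit_coord d i + \<beta> * orbit_coord c i = (\<Sum>S\<in>K. a S * orbit_coord (chord S) i)"
      "(\<Sum>S\<in>K. a S * tube_height S) < \<alpha> * height N I d + \<beta> * height N I c"
      using main[of "fst d" "fst c" "snd d" "snd c"] c by (auto simp: valid_def)
    then show ?thesis
      by (intro exI[of _ \<beta>] exI[of _ \<alpha>] exI[of _ a]) (auto simp: add.commute)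
  qed
qed

lemma height_rot: "valid c \<Longrightarrow> height N I (rot c) = height N I c"
  using I_rot rot_height by (simp add: height_def)

text \<open>A positive degree means that \<open>chord T\<close> crosses \<open>chord U\<close> or
  its image, and the image has the same orbit coordinates and height.\<close>

lemma straighten_tubes:
  assumes T: "proper_tube G T" and U: "proper_tube G U" and "\<not> tubes_compatible G T U"
  shows "\<exists>\<alpha> \<beta> a. 0 \<le> \<alpha> \<and> 0 \<le> \<beta> \<and> (\<forall>S\<in>K. 0 \<le> a S) \<and>
    (\<forall>i. \<alpha> * orbit_coord (chord T) i + \<beta> * orbit_coord (chord U) i =
      (\<Sum>S\<in>K. a S * orbit_coord (chord S) i)) \<and>
    (\<Sum>S\<in>K. a S * tube_height S) < \<alpha> * tube_height T + \<beta> * tube_height U"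
proof -
  have "T \<noteq> U" using assms(3) by (auto simp: tubes_compatible_def)
  have "compatibility_degree G T U > 0"
    using compatibility_degree_pos assms by (simp add: proper_tube_iff)
  then have "crossing (chord T) (chord U) + crossing (chord T) (rot (chord U)) > 0"
    using degree_crossing[OF T U \<open>T \<noteq> U\<close>] by (simp split: if_splits)
  then consider "crosses (chord T) (chord U)" | "crosses (chord T) (rot (chord U))"
    by (auto simp: crossing_def of_bool_def split: if_splits)
  then show ?thesis
  proof cases
    case 1
    from straighten_crossing[OF chord_valid[OF T] chord_valid[OF U] this] show ?thesis
      by (simp add: tube_height_def)
  next
    case 2
    from straighten_crossing[OF chord_valid[OF T] rot_valid[OF chord_valid[OF U]] this] show ?thesis
      using orbit_coord_rot[OF chord_valid[OF U]] height_rot[OF chord_valid[OF U]]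
      by (simp add: tube_height_def)
  qed
qed

text \<open>\<open>\<mu>\<close> rescales coordinates, for the compatibility fan;
  \<open>\<kappa>\<close> rescales generators, for the dual fan. Heights are multiplied by
  \<open>\<kappa>\<close> as well, so \<open>\<kappa>\<close> leaves every halfspace
  unchanged.\<close>

lemma polytopal_scaled_fan:
  fixes \<kappa> :: "'a set \<Rightarrow> real" and \<mu> :: "'i \<Rightarrow> real"
  assumes \<kappa>: "\<And>T. \<kappa> T > 0" and \<mu>: "\<And>i. \<mu> i > 0"
  defines "w \<equiv> \<lambda>T. \<chi> i. \<kappa> T * \<mu> i * orbit_coord (chord T) i"
  shows "polytopal {convex_cone hull (w ` \<T>) |\<T>. tubing G \<T>}"
proof -
  define h where "h = (\<lambda>T. \<kappa> T * tube_height T)"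
  define B where "B = 2 * real N ^ 2 + 1"
  have inner_w: "w T \<bullet> y = \<kappa> T * (\<Sum>i\<in>UNIV. \<mu> i * orbit_coord (chord T) i * y $ i)" for T y
    by (simp add: w_def inner_vec_def sum_distrib_left mult.assoc)
  have inner_T0: "w (T0 j) \<bullet> y = - (\<kappa> (T0 j) * \<mu> j * weight (T0 j) * y $ j)" for j y
    unfolding inner_w orbit_coord_T0 by (simp add: if_distrib if_distribR sum.delta cong: if_cong)
  have "convex_heights K (tubes_compatible G) w h"
  proof
    show "finite K" by (rule finite_K)
  next
    fix T U assume "T \<in> K" "U \<in> K" and TU: "\<not> tubes_compatible G T U"
    then have "proper_tube G T" "proper_tube G U" by (simp_all add: K_def)
    then obtain \<alpha> \<beta> a where *: "0 \<le> \<alpha>" "0 \<le> \<beta>" "\<forall>S\<in>K. 0 \<le> a S"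
      "\<forall>i. \<alpha> * orbit_coord (chord T) i + \<beta> * orbit_coord (chord U) i =
        (\<Sum>S\<in>K. a S * orbit_coord (chord S) i)"
      "(\<Sum>S\<in>K. a S * tube_height S) < \<alpha> * tube_height T + \<beta> * tube_height U"
      using straighten_tubes[OF _ _ TU] by blast
    have nz: "\<kappa> S \<noteq> 0" for S using \<kappa>[of S] by simp
    have "(\<alpha> / \<kappa> T) *\<^sub>R w T + (\<beta> / \<kappa> U) *\<^sub>R w U = (\<Sum>S\<in>K. (a S / \<kappa> S) *\<^sub>R w S)"
    proof (rule vec_eq_iff[THEN iffD2], rule allI)
      fix i
      have "((\<alpha> / \<kappa> T) *\<^sub>R w T + (\<beta> / \<kappa> U) *\<^sub>R w U) $ i =
          \<mu> i * (\<alpha> * orbit_coord (chord T) i + \<beta> * orbit_coord (chord U) i)"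
        using nz by (simp add: w_def field_simps)
      also have "\<dots> = (\<Sum>S\<in>K. (a S / \<kappa> S) *\<^sub>R w S) $ i"
        using nz by (simp add: *(4)[rule_format] w_def sum_distrib_left mult.left_commute)
      finally show "((\<alpha> / \<kappa> T) *\<^sub>R w T + (\<beta> / \<kappa> U) *\<^sub>R w U) $ i = (\<Sum>S\<in>K. (a S / \<kappa> S) *\<^sub>R w S) $ i" .
    qed
    moreover have "(\<Sum>S\<in>K. (a S / \<kappa> S) * h S) < (\<alpha> / \<kappa> T) * h T + (\<beta> / \<kappa> U) * h U"
      using *(5) nz by (simp add: h_def)
    moreover have "0 \<le> \<alpha> / \<kappa> T" "0 \<le> \<beta> / \<kappa> U" "\<forall>S\<in>K. 0 \<le> a S / \<kappa> S"
      using *(1-3) \<kappa> by (simp_all add: less_imp_le)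
    ultimately show "\<exists>\<alpha> \<beta> a. 0 \<le> \<alpha> \<and> 0 \<le> \<beta> \<and> (\<forall>S\<in>K. 0 \<le> a S) \<and>
        \<alpha> *\<^sub>R w T + \<beta> *\<^sub>R w U = (\<Sum>S\<in>K. a S *\<^sub>R w S) \<and>
        (\<Sum>S\<in>K. a S * h S) < \<alpha> * h T + \<beta> * h U"
      by (intro exI[of _ "\<alpha> / \<kappa> T"] exI[of _ "\<beta> / \<kappa> U"] exI[of _ "\<lambda>S. a S / \<kappa> S"]) simp
  next
    let ?P = "{y. \<forall>T\<in>K. w T \<bullet> y \<le> h T}"
    \<comment> \<open>The constraint of \<open>T0 i\<close> involves only the coordinate
      \<open>i\<close>, with negative coefficient, and bounds it below by
      \<open>- L i\<close>.\<close>
    define L where "L i = B / (\<mu> i * weight (T0 i))" for i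
    have lower: "- L i \<le> y $ i" if "y \<in> ?P" for y i
    proof -
      have "w (T0 i) \<bullet> y \<le> h (T0 i)" using that proper_T0 by (simp add: K_def)
      then have "\<kappa> (T0 i) * - (\<mu> i * weight (T0 i) * y $ i) \<le> \<kappa> (T0 i) * B"
        by (simp add: inner_T0 h_def tube_height_T0 B_def mult.assoc)
      then have "- (\<mu> i * weight (T0 i) * y $ i) \<le> B" using \<kappa>[of "T0 i"] by (simp only: mult_le_cancel_left_pos)
      moreover have "\<mu> i * weight (T0 i) > 0" using \<mu> weight_pos by simp
      ultimately show ?thesis by (simp add: L_def field_simps)
    qed
    have "\<exists>u. \<forall>y\<in>?P. y $ i \<le> u" for i
    proof -
      \<comment> \<open>A noninitial tube has nonnegative coordinates, and one incompatible with
        \<open>T0 i\<close> is positive at \<open>i\<close>. With the other coordinates bounded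
        below, its constraint bounds \<open>y $ i\<close> above.\<close>
      obtain T where T: "proper_tube G T" "\<not> tubes_compatible G (T0 i) T"
        using incompatible_proper_tube[OF proper_T0] by metis
      have Tr: "T \<notin> range T0" using T(2) compatible_T0 by auto
      let ?z = "\<lambda>j. \<mu> j * orbit_coord (chord T) j"
      have nn: "?z j \<ge> 0" for j using orbit_coord_nonneg[OF T(1) Tr] \<mu>[of j] by simp
      have "compatibility_degree G (T0 i) T > 0"
        using compatibility_degree_pos T proper_T0 by (simp add: proper_tube_iff)
      then have zi: "?z i > 0" using orbit_coord_primal[OF T(1), of i] \<mu>[of i] weight_pos by simp
      let ?u = "(tube_height T + (\<Sum>j\<in>UNIV - {i}. ?z j * L j)) / ?z i"
      have "y $ i \<le> ?u" if y: "y \<in> ?P" for y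
      proof -
        have "w T \<bullet> y \<le> h T" using y T(1) by (simp add: K_def)
        then have "(\<Sum>j\<in>UNIV. ?z j * y $ j) \<le> tube_height T"
          using \<kappa>[of T] by (simp only: inner_w h_def mult_le_cancel_left_pos)
        then have "?z i * y $ i + (\<Sum>j\<in>UNIV - {i}. ?z j * y $ j) \<le> tube_height T"
          by (simp add: sum.remove[of UNIV i])
        moreover have "(\<Sum>j\<in>UNIV - {i}. ?z j * - L j) \<le> (\<Sum>j\<in>UNIV - {i}. ?z j * y $ j)"
          using lower[OF y] nn by (intro sum_mono mult_left_mono)
        ultimately have "?z i * y $ i \<le> tube_height T + (\<Sum>j\<in>UNIV - {i}. ?z j * L j)"
          by (simp add: sum_negf)
        then show ?thesis using zi by (simp add: pos_le_divide_eq mult.commute)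
      qed
      then show ?thesis by blast
    qed
    then obtain u where u: "\<forall>i. \<forall>y\<in>?P. y $ i \<le> u i"
      using choice[of "\<lambda>i u. \<forall>y\<in>?P. y $ i \<le> u"] by blast
    have "?P \<subseteq> cbox (\<chi> i. - L i) (\<chi> i. u i)"
      using lower u by (auto simp: mem_box_cart)
    then show "bounded ?P" using bounded_cbox bounded_subset by blast
  qed
  then interpret H: convex_heights K "tubes_compatible G" w h .
  have cs: "H.compat_set \<T> \<longleftrightarrow> tubing G \<T>" for \<T>
    unfolding H.compat_set_def tubing_def by (auto simp: K_def)
  \<comment> \<open>The cardinality makes the tubing of a vertex maximal and gives the bound that
    \<open>vertex_flip\<close> asks for.\<close>
  define good where "good \<T> \<longleftrightarrow> H.is_vertex \<T> \<and> card \<T> + 1 = card V" for \<T>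
  have good_max: "maximal_tubing G \<T>" if "good \<T>" for \<T>
    unfolding maximal_tubing_def
  proof (intro conjI allI impI)
    show "tubing G \<T>" using that H.vertex_compat_set cs by (simp add: good_def)
    fix \<S> assume S: "tubing G \<S> \<and> \<T> \<subseteq> \<S>"
    then have "card \<S> \<le> card \<T>" using card_tubing[of \<S>] that by (simp add: good_def)
    then show "\<S> = \<T>" using S finite_tubing card_seteq by blast
  qed
  have "good (range T0)"
    unfolding good_def
  proof
    show "card (range T0) + 1 = card V" by (rule card_maximal_tubing[OF maximal_T0])
    \<comment> \<open>Solves the equations of all initial tubes. Its coordinates are negative, so
      the other constraints, with nonnegative coefficients and positive heights, are strict.\<close>
    define y0 :: "real ^ 'i" where "y0 = (\<chi> i. - B / (\<mu> i * weight (T0 i)))"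
    have pos: "\<mu> i * weight (T0 i) > 0" for i using \<mu> weight_pos by simp
    have B: "B > 0" by (simp add: B_def add_nonneg_pos)
    have eq: "w (T0 j) \<bullet> y0 = h (T0 j)" for j
    proof -
      have "\<mu> j * weight (T0 j) * (- B / (\<mu> j * weight (T0 j))) = - B"
        using \<mu>[of j] weight_pos[of "T0 j"] by simp
      then show ?thesis
        by (simp only: inner_T0 y0_def h_def tube_height_T0 B_def[symmetric] vec_lambda_beta mult.assoc)
    qed
    have lt: "w T \<bullet> y0 < h T" if T: "T \<in> K" "T \<notin> range T0" for T
    proof -
      have pT: "proper_tube G T" using T by (simp add: K_def)
      have "\<mu> i * orbit_coord (chord T) i * y0 $ i \<le> 0" for i
      proof -
        have "y0 $ i \<le> 0" using pos[of i] B by (simp add: y0_def less_imp_le)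
        moreover have "0 \<le> \<mu> i * orbit_coord (chord T) i"
          using orbit_coord_nonneg[OF pT T(2)] \<mu>[of i] by simp
        ultimately show ?thesis by (rule mult_nonneg_nonpos[rotated])
      qed
      then have "(\<Sum>i\<in>UNIV. \<mu> i * orbit_coord (chord T) i * y0 $ i) \<le> 0" by (intro sum_nonpos)
      then have "w T \<bullet> y0 \<le> 0"
        unfolding inner_w using \<kappa>[of T] by (simp add: mult_nonneg_nonpos)
      also have "0 < h T" using tube_height_pos[OF pT T(2)] \<kappa> by (simp add: h_def)
      finally show ?thesis .
    qed
    have "y0 \<in> H.P"
      unfolding H.P_def
    proof (intro CollectI ballI)
      fix T assume "T \<in> K"
      then show "w T \<bullet> y0 \<le> h T"
        using eq lt[of T] by (cases "T \<in> range T0") auto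
    qed
    moreover have "H.active y0 = range T0"
      using eq lt proper_T0 unfolding H.active_def by (force simp: K_def)
    moreover have "\<exists>d. w S \<bullet> d = - 1 \<and> (\<forall>T\<in>range T0 - {S}. w T \<bullet> d = 0)" if S: "S \<in> range T0" for S
    proof -
      obtain j where j: "S = T0 j" using S by blast
      let ?d = "axis j (1 / (\<kappa> (T0 j) * \<mu> j * weight (T0 j))) :: real ^ 'i"
      have "\<kappa> (T0 j) \<noteq> 0" "\<mu> j \<noteq> 0" "weight (T0 j) \<noteq> 0"
        using \<kappa>[of "T0 j"] \<mu>[of j] weight_pos[of "T0 j"] by simp_all
      then have "w S \<bullet> ?d = - 1" unfolding j inner_T0 by (simp add: axis_def)
      moreover have "w T \<bullet> ?d = 0" if T: "T \<in> range T0 - {S}" for T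
      proof -
        obtain x where x: "T = T0 x" "x \<noteq> j" using T j by blast
        then show ?thesis by (simp add: inner_T0 axis_def)
      qed
      ultimately show ?thesis by blast
    qed
    ultimately show "H.is_vertex (range T0)" unfolding H.is_vertex_def by blast
  qed
  then have ex: "\<exists>\<T>. good \<T>" by blast
  have flip: "\<exists>U. U \<notin> \<T> \<and> good (insert U (\<T> - {S}))" if \<T>: "good \<T>" and S: "S \<in> \<T>" for \<T> S
  proof -
    have pure: "card \<U> \<le> card \<T>" if "H.compat_set \<U>" for \<U>
      using that card_tubing[of \<U>] \<T> cs by (simp add: good_def)
    have vert: "H.is_vertex \<T>" using \<T> by (simp add: good_def)
    obtain U where U: "U \<in> K - \<T>" "H.is_vertex (insert U (\<T> - {S}))"
      by (rule H.vertex_flip[OF vert S pure])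
    have fin: "finite \<T>" using good_max[OF \<T>] finite_tubing by (simp add: maximal_tubing_def)
    have "card (insert U (\<T> - {S})) = Suc (card (\<T> - {S}))"
      using U(1) fin by (intro card_insert_disjoint) auto
    then have "card (insert U (\<T> - {S})) = card \<T>" by (simp only: card_Suc_Diff1[OF fin S])
    then show ?thesis using U \<T> unfolding good_def by (metis DiffD2)
  qed
  have "\<exists>\<U>. H.is_vertex \<U> \<and> \<T> \<subseteq> \<U>" if "H.compat_set \<T>" for \<T>
    using flip_connected[OF good_max ex flip, of \<T>] that cs unfolding good_def by blast
  from H.polytopal_fan[OF this] show ?thesis unfolding cs .
qed

theorem polytopal_compatibility_fans:
  "polytopal (compatibility_fan G T0)" "polytopal (dual_compatibility_fan G T0)"
proof -
  have img: "f ` \<T> = g ` \<T>" if "tubing G \<T>" "\<And>T. proper_tube G T \<Longrightarrow> f T = g T"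
    for \<T> and f g :: "'a set \<Rightarrow> real ^ 'i"
    using that by (intro image_cong) (auto simp: tubing_def)
  have fan: "{convex_cone hull (f ` \<T>) |\<T>. tubing G \<T>} = {convex_cone hull (g ` \<T>) |\<T>. tubing G \<T>}"
    if "\<And>T. proper_tube G T \<Longrightarrow> f T = g T" for f g :: "'a set \<Rightarrow> real ^ 'i"
  proof (rule Collect_cong, rule ex_cong1)
    show "(X = convex_cone hull (f ` \<T>) \<and> tubing G \<T>) \<longleftrightarrow> (X = convex_cone hull (g ` \<T>) \<and> tubing G \<T>)" for X \<T>
      using img[of \<T> f g] that by auto
  qed
  have nz: "weight T \<noteq> 0" for T using weight_pos[of T] by simp
  have "compatibility_vector G T0 T = (\<chi> i. 1 * (1 / weight (T0 i)) * orbit_coord (chord T) i)"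
    if "proper_tube G T" for T
    using nz orbit_coord_primal[OF that] by (simp add: compatibility_vector_def)
  from fan[OF this] show "polytopal (compatibility_fan G T0)"
    unfolding compatibility_fan_def
    using polytopal_scaled_fan[of "\<lambda>_. 1" "\<lambda>i. 1 / weight (T0 i)"] weight_pos by simp
  have "dual_compatibility_vector G T0 T = (\<chi> i. (1 / weight T) * 1 * orbit_coord (chord T) i)"
    if "proper_tube G T" for T
    using nz orbit_coord_dual[OF that] by (simp add: dual_compatibility_vector_def)
  from fan[OF this] show "polytopal (dual_compatibility_fan G T0)"
    unfolding dual_compatibility_fan_def
    using polytopal_scaled_fan[of "\<lambda>T. 1 / weight T" "\<lambda>_. 1"] weight_pos by simp
qed

end

text \<open>Applied with the identity to intervals and with reduction modulo \<open>m\<close> to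
  arcs of the cycle.\<close>

lemma tube_image:
  assumes G: "pair_graph G" and ab: "a < b" and sub: "f ` {a..<b} \<subseteq> pverts G"
    and step: "\<And>i. a \<le> i \<Longrightarrow> Suc i < b \<Longrightarrow> (f i, f (Suc i)) \<in> parcs G"
  shows "tube G (f ` {a..<b})"
proof -
  let ?T = "f ` {a..<b}"
  let ?R = "(parcs G \<inter> ?T \<times> ?T)\<^sup>*"
  have sym: "(v, u) \<in> parcs G" if "(u, v) \<in> parcs G" for u v
    using G that by (simp add: pair_graph_def pair_pseudo_graph_def pair_sym_digraph.arcs_symmetric)
  have from_a: "(f a, f i) \<in> ?R" if "a \<le> i" "i < b" for i
    using that
  proof (induction i rule: dec_induct)
    case (step i)
    have "(f a, f i) \<in> ?R" using step by simp
    moreover have "(f i, f (Suc i)) \<in> parcs G \<inter> ?T \<times> ?T" using assms(4) step by simp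
    ultimately show ?case by (rule rtrancl_into_rtrancl)
  qed simp
  have "sym ?R" by (rule sym_rtrancl) (auto simp: sym_def sym)
  then have "(f i, f a) \<in> ?R" if "a \<le> i" "i < b" for i
    using from_a[OF that] by (auto dest: symD)
  then have "(f i, f j) \<in> ?R" if "a \<le> i" "i < b" "a \<le> j" "j < b" for i j
    using from_a that by (meson rtrancl_trans)
  then show ?thesis using ab sub by (auto simp: tube_iff[OF G])
qed

section \<open>Paths\<close>

context
  fixes m :: nat
  assumes m: "m \<ge> 1"
begin

lemma path_interval_tube: "a < b \<Longrightarrow> b \<le> m \<Longrightarrow> tube (path_graph m) {a..<b}"
proof -
  assume "a < b" "b \<le> m"
  then have "tube (path_graph m) ((\<lambda>i. i) ` {a..<b})"
    by (intro tube_image[OF pair_graph_path_graph]) (auto simp: path_graph_def)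
  then show "tube (path_graph m) {a..<b}" by simp
qed

lemma path_verts: "pverts (path_graph m) = {0..<m}"
  by (simp add: path_graph_def lessThan_atLeast0)

lemma connected_path_graph: "connected_pair_graph (path_graph m)"
  using path_interval_tube[of 0 m] m pair_graph_path_graph
  by (simp add: connected_pair_graph_def path_verts)

interpretation connected_pair_graph "path_graph m"
  by (rule connected_path_graph)

text \<open>If some \<open>x\<close> between two vertices of \<open>T\<close> were missing, the edge
  leaving the part below \<open>x\<close> would have to jump over \<open>x\<close>.\<close>

lemma path_tubeE:
  assumes T: "tube (path_graph m) T"
  obtains a b where "a < b" "b \<le> m" "T = {a..<b}"
proof -
  have fin: "finite T" "T \<noteq> {}" using finite_tube[OF T] tube_nonempty[OF T] by auto
  have le: "x < m" if "x \<in> T" for x using tube_subset[OF T] that by (auto simp: path_verts)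
  have "T = {Min T..<Suc (Max T)}"
  proof
    show "T \<subseteq> {Min T..<Suc (Max T)}" using fin by (auto simp: less_Suc_eq_le)
    show "{Min T..<Suc (Max T)} \<subseteq> T"
    proof (rule subsetI, rule ccontr)
      fix x assume x: "x \<in> {Min T..<Suc (Max T)}" "x \<notin> T"
      have mn: "Min T \<in> T" "Max T \<in> T" using fin by auto
      have "Min T \<noteq> x" "Max T \<noteq> x" using mn x(2) by auto
      moreover have "Min T \<le> x" "x \<le> Max T" using x(1) by auto
      ultimately have lt: "Min T < x" "x < Max T" by auto
      have "T \<inter> {..<x} \<noteq> {}" using mn(1) lt(1) by blast
      moreover have "Max T \<notin> T \<inter> {..<x}" using lt(2) by simp
      then have "T \<inter> {..<x} \<noteq> T" using mn(2) by blast
      ultimately obtain y z where yz: "y \<in> T \<inter> {..<x}" "z \<in> T - T \<inter> {..<x}" "(y, z) \<in> parcs (path_graph m)"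
        using tube_cut[OF T, of "T \<inter> {..<x}"] by blast
      then have "z = y + 1 \<or> y = z + 1" by (simp add: path_graph_def)
      moreover have "y < x" "x < z"
        using yz x(2) by (auto simp: not_less intro: le_neq_implies_less)
      ultimately show False by linarith
    qed
  qed
  moreover have "Min T < Suc (Max T)" "Suc (Max T) \<le> m"
    using fin le[of "Max T"] by (auto simp: less_Suc_eq_le Suc_le_eq)
  ultimately show thesis using that by blast
qed

text \<open>The path vertex \<open>v\<close> is read as the polygon vertex \<open>v + 1\<close>, and
  the chord cuts off exactly the vertices of the tube; this explains the shift by 2 at the upper
  end.\<close>

definition path_chord :: "nat set \<Rightarrow> nat \<times> nat" where
  "path_chord T = (Min T, Max T + 2)"

lemma path_chord_interval: "a < b \<Longrightarrow> path_chord {a..<b} = (a, Suc b)"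
proof -
  assume "a < b"
  then have "Min {a..<b} = a" by (intro Min_eqI) auto
  moreover have "Max {a..<b} = b - 1" using \<open>a < b\<close> by (intro Max_eqI) auto
  ultimately show "path_chord {a..<b} = (a, Suc b)" using \<open>a < b\<close> by (simp add: path_chord_def)
qed

lemma path_properE:
  assumes "proper_tube (path_graph m) T"
  obtains a b where "a < b" "b \<le> m" "T = {a..<b}" "path_chord T = (a, Suc b)"
proof -
  have "tube (path_graph m) T" using assms by (simp add: proper_tube_iff)
  then obtain a b where ab: "a < b" "b \<le> m" "T = {a..<b}" by (rule path_tubeE)
  show thesis by (rule that[OF ab]) (simp add: ab path_chord_interval)
qed

text \<open>The outer neighbours of the first interval are \<open>a - 1\<close> and
  \<open>b\<close>. The second interval contains both only if it contains the first, and then the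
  degree is 0; so the degree is at most 1. Adjacent disjoint intervals do have crossing chords,
  because a chord ends one vertex beyond its tube on either side.\<close>

lemma path_degree:
  assumes ab: "a < b" "b \<le> m" and cd: "c < d" "d \<le> m" and ne: "{a..<b} \<noteq> {c..<d}"
  shows "real_of_int (compatibility_degree (path_graph m) {a..<b} {c..<d}) =
    crossing (a, Suc b) (c, Suc d)"
proof -
  define S where "S = {v \<in> {c..<d} - {a..<b}. \<exists>u\<in>{a..<b}. (u, v) \<in> parcs (path_graph m)}"
  have deg: "compatibility_degree (path_graph m) {a..<b} {c..<d} = int (card S)"
    if "\<not> {a..<b} \<subseteq> {c..<d}"
    using that ne by (simp add: compatibility_degree_def S_def)
  have sub: "{a..<b} \<subseteq> {c..<d} \<longleftrightarrow> c \<le> a \<and> b \<le> d" using ab by auto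
  have N: "S = {v. c \<le> v \<and> v < d \<and> (v = b \<or> Suc v = a)}"
  proof (intro set_eqI iffI)
    fix v assume "v \<in> S"
    then show "v \<in> {v. c \<le> v \<and> v < d \<and> (v = b \<or> Suc v = a)}"
      by (auto simp: S_def path_graph_def)
  next
    fix v assume "v \<in> {v. c \<le> v \<and> v < d \<and> (v = b \<or> Suc v = a)}"
    then have v: "c \<le> v" "v < d" "v = b \<or> Suc v = a" by auto
    have "(if v = b then b - 1 else a, v) \<in> parcs (path_graph m)" "(if v = b then b - 1 else a) \<in> {a..<b}"
      using v ab cd by (auto simp: path_graph_def)
    then show "v \<in> S" using v ab unfolding S_def by fastforce
  qed
  consider "c \<le> a" "b \<le> d" | "a < c" "c \<le> b" "b < d" | "c < a" "a \<le> d" "d < b"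
    | "d < a" | "b < c" | "a \<le> c" "d \<le> b" "\<not> (c \<le> a \<and> b \<le> d)" by linarith
  then show ?thesis
  proof cases
    case 1
    then have "\<not> crosses (a, Suc b) (c, Suc d)" by (auto simp: crosses_def)
    then show ?thesis using 1 ne sub
      by (simp add: compatibility_degree_def crossing_def)
  next
    case 2
    then have "S = {b}" using N by auto
    moreover have "crosses (a, Suc b) (c, Suc d)" "\<not> {a..<b} \<subseteq> {c..<d}"
      using 2 by (auto simp: crosses_def sub)
    ultimately show ?thesis by (simp add: deg crossing_def)
  next
    case 3
    then have "S = {a - 1}" using N by auto
    moreover have "crosses (a, Suc b) (c, Suc d)" "\<not> {a..<b} \<subseteq> {c..<d}"
      using 3 by (auto simp: crosses_def sub)
    ultimately show ?thesis by (simp add: deg crossing_def)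
  next
    case 4
    have "S = {}" using 4 N ab by auto
    moreover have "\<not> crosses (a, Suc b) (c, Suc d)" "\<not> {a..<b} \<subseteq> {c..<d}"
      using 4 ab cd by (auto simp: crosses_def sub)
    ultimately show ?thesis by (simp add: deg crossing_def)
  next
    case 5
    have "S = {}" using 5 N ab by auto
    moreover have "\<not> crosses (a, Suc b) (c, Suc d)" "\<not> {a..<b} \<subseteq> {c..<d}"
      using 5 ab cd by (auto simp: crosses_def sub)
    ultimately show ?thesis by (simp add: deg crossing_def)
  next
    case 6
    have "S = {}" using 6 N by auto
    moreover have "\<not> crosses (a, Suc b) (c, Suc d)" "\<not> {a..<b} \<subseteq> {c..<d}"
      using 6 ab cd by (auto simp: crosses_def sub)
    ultimately show ?thesis by (simp add: deg crossing_def)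
  qed
qed

text \<open>With the identity as \<open>rot\<close> all weights are 2 and both sides of the degree
  formula are doubled. A chord that crosses another is no edge of the polygon; in particular it is
  not \<open>(0, m + 1)\<close>, which would give the whole path.\<close>

lemma chord_model_path: "chord_model (path_graph m) (m + 2) (\<lambda>c. c) path_chord"
proof (intro chord_model.intro chord_model_axioms.intro connected_path_graph)
  fix T assume "proper_tube (path_graph m) T"
  then obtain a b where "a < b" "b \<le> m" "path_chord T = (a, Suc b)" by (rule path_properE)
  then show "fst (path_chord T) < snd (path_chord T) \<and> snd (path_chord T) < m + 2" by simp
next
  fix c d :: "nat \<times> nat"
  assume c: "fst c < snd c \<and> snd c < m + 2" and d: "fst d < snd d \<and> snd d < m + 2" and cd: "crosses c d"
  define a b where "a = fst c" and "b = snd c - 1"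
  have ab: "a < b" "b \<le> m" "\<not> (a = 0 \<and> b = m)" "c = (a, Suc b)"
    using c d cd by (auto simp: a_def b_def crosses_def prod_eq_iff)
  have "{a..<b} \<noteq> {0..<m}" using ab m atLeastLessThan_eq_iff[of a b 0 m] by simp
  then have "proper_tube (path_graph m) {a..<b}"
    using ab path_interval_tube by (simp add: proper_tube_iff path_verts)
  then show "\<exists>T. proper_tube (path_graph m) T \<and> (path_chord T = c \<or> path_chord T = c)"
    using path_chord_interval[OF ab(1)] ab(4) by auto
next
  fix T U assume T: "proper_tube (path_graph m) T" and U: "proper_tube (path_graph m) U"
    and eq: "path_chord T = path_chord U \<or> path_chord T = path_chord U"
  obtain a b where ab: "T = {a..<b}" "path_chord T = (a, Suc b)" using T by (rule path_properE)
  obtain c d where cd: "U = {c..<d}" "path_chord U = (c, Suc d)" using U by (rule path_properE)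
  have "(a, Suc b) = (c, Suc d)" using eq ab(2) cd(2) by simp
  then show "T = U" using ab(1) cd(1) by simp
next
  fix T U assume TU: "proper_tube (path_graph m) T" "proper_tube (path_graph m) U" "T \<noteq> U"
  obtain a b where "a < b" "b \<le> m" "T = {a..<b}" "path_chord T = (a, Suc b)"
    using TU(1) by (rule path_properE)
  moreover obtain c d where "c < d" "d \<le> m" "U = {c..<d}" "path_chord U = (c, Suc d)"
    using TU(2) by (rule path_properE)
  ultimately show "(if path_chord T = path_chord T then 2 else 1) *
      real_of_int (compatibility_degree (path_graph m) T U) =
      crossing (path_chord T) (path_chord U) + crossing (path_chord T) (path_chord U)"
    using path_degree[of a b c d] TU(3) by simp
qed (simp_all add: crosses_def)

end

section \<open>Cycles\<close>

context
  fixes m :: nat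
  assumes m: "m \<ge> 3"
begin

text \<open>\<open>p\<close> and \<open>q\<close> are the vertices just before and just after the
  arc, with \<open>q\<close> not reduced modulo \<open>m\<close>; the second alternative is the part
  past vertex 0.\<close>

definition circle_arc :: "nat \<Rightarrow> nat \<Rightarrow> nat set" where
  "circle_arc p q = {v. v < m \<and> (p < v \<and> v < q \<or> p < v + m \<and> v + m < q)}"

text \<open>Selects one chord from each orbit of diagonals of the \<open>2m\<close>-gon under the
  half turn: first end below \<open>m\<close>, length from 2 to \<open>m\<close>. Length
  \<open>m\<close> gives the diameters, which are the tubes missing just one vertex.\<close>

definition arc_ends :: "nat \<Rightarrow> nat \<Rightarrow> bool" where
  "arc_ends p q \<longleftrightarrow> p < m \<and> p + 2 \<le> q \<and> q \<le> p + m"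

lemma arc_image: "q \<le> 2 * m \<Longrightarrow> circle_arc p q = (\<lambda>x. x mod m) ` {Suc p..<q}"
proof (intro set_eqI iffI)
  fix v assume q: "q \<le> 2 * m" and v: "v \<in> circle_arc p q"
  then consider "v < m" "p < v" "v < q" | "v < m" "p < v + m" "v + m < q" by (auto simp: circle_arc_def)
  then show "v \<in> (\<lambda>x. x mod m) ` {Suc p..<q}"
  proof cases
    case 1
    then show ?thesis by (intro image_eqI[of _ _ v]) auto
  next
    case 2
    then show ?thesis by (intro image_eqI[of _ _ "v + m"]) auto
  qed
next
  fix v assume q: "q \<le> 2 * m" and "v \<in> (\<lambda>x. x mod m) ` {Suc p..<q}"
  then obtain x where "x \<in> {Suc p..<q}" and v: "v = x mod m" by blast
  then have x: "p < x" "x < q" by auto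
  show "v \<in> circle_arc p q"
  proof (cases "x < m")
    case True
    then show ?thesis using x v by (simp add: circle_arc_def)
  next
    case False
    then have "x mod m = x - m" using x q by (simp add: le_mod_geq)
    then show ?thesis using x v q False m by (auto simp: circle_arc_def)
  qed
qed

lemma cycle_edge_iff:
  assumes "u < m" "v < m"
  shows "(u, v) \<in> parcs (cycle_graph m) \<longleftrightarrow>
    v = Suc u \<or> u = Suc v \<or> u = 0 \<and> Suc v = m \<or> v = 0 \<and> Suc u = m"
proof -
  have "(x + 1) mod m = (if Suc x = m then 0 else Suc x)" if "x < m" for x
    using that by simp
  then show ?thesis using assms by (auto simp: cycle_graph_def)
qed

lemma arc_tube: "arc_ends p q \<Longrightarrow> tube (cycle_graph m) (circle_arc p q)"
proof -
  assume pq: "arc_ends p q"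
  have "tube (cycle_graph m) ((\<lambda>x. x mod m) ` {Suc p..<q})"
  proof (rule tube_image[OF pair_graph_cycle_graph[OF m]])
    show "Suc p < q" using pq by (simp add: arc_ends_def)
    show "(\<lambda>x. x mod m) ` {Suc p..<q} \<subseteq> pverts (cycle_graph m)"
      using m by (auto simp: cycle_graph_def)
    show "(i mod m, Suc i mod m) \<in> parcs (cycle_graph m)" for i
      using m by (simp add: cycle_graph_def mod_simps)
  qed
  then show ?thesis using arc_image[of q p] pq by (simp add: arc_ends_def)
qed

lemma cycle_verts: "pverts (cycle_graph m) = {0..<m}"
  by (simp add: cycle_graph_def lessThan_atLeast0)

lemma connected_cycle_graph: "connected_pair_graph (cycle_graph m)"
proof -
  have "tube (cycle_graph m) ((\<lambda>i. i) ` {0..<m})"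
    by (rule tube_image[OF pair_graph_cycle_graph[OF m]]) (use m in \<open>auto simp: cycle_graph_def\<close>)
  then show ?thesis
    using pair_graph_cycle_graph[OF m] by (simp add: connected_pair_graph_def cycle_verts)
qed

interpretation connected_pair_graph "cycle_graph m"
  by (rule connected_cycle_graph)

lemma arc_proper: "arc_ends p q \<Longrightarrow> proper_tube (cycle_graph m) (circle_arc p q)"
proof -
  assume pq: "arc_ends p q"
  then have "p \<in> {0..<m}" "p \<notin> circle_arc p q" by (simp_all add: circle_arc_def arc_ends_def)
  then have "circle_arc p q \<noteq> {0..<m}" by metis
  then show ?thesis using arc_tube[OF pq] by (simp add: proper_tube_iff cycle_verts)
qed

text \<open>Cutting the cycle at a vertex \<open>r\<close> outside the tube turns it into an interval.\<close>

lemma cycle_tubeE: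
  assumes "proper_tube (cycle_graph m) T"
  obtains p q where "arc_ends p q" "T = circle_arc p q"
proof -
  have T: "tube (cycle_graph m) T" "T \<noteq> {0..<m}" "T \<subseteq> {0..<m}" "T \<noteq> {}"
    using assms tube_subset tube_nonempty by (auto simp: proper_tube_iff cycle_verts)
  then obtain r where "r \<in> {0..<m}" and r': "r \<notin> T" by blast
  then have r: "r < m" "r \<notin> T" by auto
  define g where "g x = (r + x) mod m" for x
  have g_inj: "x = y" if "g x = g y" "x < m" "y < m" for x y
    using that r by (auto simp: g_def mod_if split: if_splits)
  have g_surj: "\<exists>x<m. v = g x" if "v < m" for v
  proof (cases "r \<le> v")
    case True
    then show ?thesis using that by (intro exI[of _ "v - r"]) (auto simp: g_def)
  next
    case False
    then show ?thesis using that r by (intro exI[of _ "v + m - r"]) (auto simp: g_def)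
  qed
  define S where "S = {x. x < m \<and> g x \<in> T}"
  have TS: "T = g ` S"
  proof
    show "g ` S \<subseteq> T" by (auto simp: S_def)
    show "T \<subseteq> g ` S"
    proof
      fix v assume "v \<in> T"
      then have "v < m" using T(3) by auto
      then obtain x where "x < m" "v = g x" using g_surj by blast
      then show "v \<in> g ` S" using \<open>v \<in> T\<close> by (simp add: S_def)
    qed
  qed
  have "finite S" by (simp add: S_def)
  moreover have "S \<noteq> {}" using T(4) TS by blast
  moreover have "0 \<notin> S" using r by (simp add: S_def g_def)
  ultimately have S: "finite S" "S \<noteq> {}" "0 \<notin> S" by blast+
  have mn: "Min S \<in> S" "Max S \<in> S" using S by auto
  have S_lt: "x < m" if "x \<in> S" for x using that by (simp add: S_def)
  have "S = {Min S..Max S}"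
  proof
    show "S \<subseteq> {Min S..Max S}" using S by auto
    show "{Min S..Max S} \<subseteq> S"
    proof (rule subsetI, rule ccontr)
      fix x assume x: "x \<in> {Min S..Max S}" "x \<notin> S"
      have "Min S \<noteq> x" "Max S \<noteq> x" using mn x(2) by auto
      moreover have "Min S \<le> x" "x \<le> Max S" using x(1) by auto
      ultimately have lt: "Min S < x" "x < Max S" by auto
      \<comment> \<open>As on a path: an edge leaving the part before \<open>x\<close> would have to
        jump over \<open>x\<close> or use position 0, which is the removed vertex
        \<open>r\<close>.\<close>
      let ?Y = "g ` (S \<inter> {..<x})"
      have "g (Max S) \<notin> ?Y"
      proof
        assume "g (Max S) \<in> ?Y"
        then obtain i where i: "i \<in> S" "i < x" "g (Max S) = g i" by blast
        have "Max S = i" by (rule g_inj[OF i(3) S_lt[OF mn(2)] S_lt[OF i(1)]])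
        then show False using i(2) lt(2) by simp
      qed
      then have "?Y \<noteq> T" using TS mn(2) by blast
      moreover have "?Y \<subseteq> T" using TS by blast
      moreover have "?Y \<noteq> {}" using mn(1) lt(1) by blast
      ultimately obtain y z where yz: "y \<in> ?Y" "z \<in> T - ?Y" "(y, z) \<in> parcs (cycle_graph m)"
        using tube_cut[OF T(1), of ?Y] by blast
      then obtain i where i: "i \<in> S" "i < x" "y = g i" by blast
      obtain j where j: "j \<in> S" "z = g j" using yz(2) TS by blast
      have "\<not> j < x" using j yz(2) by blast
      then have ij: "x \<le> j" by simp
      have lim: "i < m" "j < m" using i(1) j(1) by (simp_all add: S_def)
      have "i \<noteq> 0" "x \<noteq> j" using i(1) j(1) S(3) x(2) by metis+
      have "z = (y + 1) mod m \<or> y = (z + 1) mod m" using yz(3) by (simp add: cycle_graph_def)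
      then consider "g j = g (Suc i)" | "g i = g (Suc j)"
        using i(3) j(2) by (auto simp: g_def mod_simps)
      then show False
      proof cases
        case 1
        have "j = Suc i" using lim i(2) ij \<open>x \<noteq> j\<close> by (intro g_inj[OF 1]) auto
        then show False using i(2) ij \<open>x \<noteq> j\<close> by simp
      next
        case 2
        show False
        proof (cases "Suc j < m")
          case True
          have "i = Suc j" using lim True by (intro g_inj[OF 2]) auto
          then show False using i(2) ij by simp
        next
          case False
          then have "Suc j = m" using lim by simp
          then have "g i = g 0" using 2 by (simp add: g_def)
          then have "i = 0" by (rule g_inj) (use lim in simp_all)
          then show False using \<open>i \<noteq> 0\<close> by simp
        qed
      qed
    qed
  qed
  moreover define a b where "a = Min S" and "b = Max S"
  ultimately have Sab: "S = {a..b}" by simp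
  have ab: "0 < a" "a \<le> b" "b < m"
  proof -
    have "a \<in> S" "b \<in> S" using mn by (simp_all only: a_def b_def)
    then show "b < m" "a \<le> b" using S_lt Sab by auto
    show "0 < a" using \<open>a \<in> S\<close> S(3) by (metis gr0I)
  qed
  \<comment> \<open>The vertex before the arc is \<open>g (a - 1)\<close>; \<open>a\<close> is
    positive because \<open>g 0 = r\<close> lies outside \<open>T\<close>.\<close>
  define p where "p = (r + a - 1) mod m"
  define q where "q = p + (b - a) + 2"
  have p: "p < m" using m by (simp add: p_def)
  have ends: "arc_ends p q" using ab p by (auto simp: arc_ends_def q_def)
  have step: "(Suc p + k) mod m = g (a + k)" for k
  proof -
    have "(Suc k + (r + a - 1) mod m) mod m = (Suc k + (r + a - 1)) mod m"
      by (rule mod_add_right_eq)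
    also have "Suc k + (r + a - 1) = r + (a + k)" using ab(1) by simp
    finally have "(Suc k + p) mod m = g (a + k)" by (simp only: p_def g_def)
    then show ?thesis by (simp add: add.commute)
  qed
  have "circle_arc p q = (\<lambda>x. x mod m) ` {Suc p..<q}" using ends by (intro arc_image) (simp add: arc_ends_def)
  also have "{Suc p..<q} = (\<lambda>k. Suc p + k) ` {..b - a}"
  proof -
    have "x \<in> (\<lambda>k. Suc p + k) ` {..b - a}" if "x \<in> {Suc p..<q}" for x
      using that by (intro image_eqI[of _ _ "x - Suc p"]) (auto simp: q_def)
    then show ?thesis by (auto simp: q_def)
  qed
  also have "(\<lambda>x. x mod m) ` (\<lambda>k. Suc p + k) ` {..b - a} = g ` (\<lambda>k. a + k) ` {..b - a}"
    by (simp add: image_image step del: add_Suc)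
  also have "(\<lambda>k. a + k) ` {..b - a} = S"
  proof -
    have "x \<in> (\<lambda>k. a + k) ` {..b - a}" if "x \<in> {a..b}" for x
      using that by (intro image_eqI[of _ _ "x - a"]) auto
    then show ?thesis using ab Sab by auto
  qed
  finally show thesis using that ends TS by simp
qed

lemma arc_mem:
  assumes "arc_ends p q" "v < m"
  shows "v \<in> circle_arc p q \<longleftrightarrow> p < v \<and> v < q \<or> v + m < q"
  using assms by (auto simp: circle_arc_def arc_ends_def)

definition wrap :: "nat \<Rightarrow> nat" where
  "wrap x = (if x < m then x else x - m)"

text \<open>On the unrolled cycle the larger arc contains the smaller one or its translate by
  \<open>m\<close>, whose lower end lies above \<open>c\<close> automatically. Two test vertices
  suffice: the first vertex of the smaller arc, and the vertex just after the larger one.\<close>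

lemma arc_subset_iff:
  assumes pq: "arc_ends p q" and cd: "arc_ends c d"
  shows "circle_arc p q \<subseteq> circle_arc c d \<longleftrightarrow> c \<le> p \<and> q \<le> d \<or> q + m \<le> d"
proof
  assume sub: "circle_arc p q \<subseteq> circle_arc c d"
  have p1: "wrap (Suc p) < m" and d1: "wrap d < m"
    using pq cd m by (auto simp: wrap_def arc_ends_def)
  have "wrap (Suc p) \<in> circle_arc p q"
    unfolding arc_mem[OF pq p1] using pq by (auto simp: wrap_def arc_ends_def)
  then have "wrap (Suc p) \<in> circle_arc c d" using sub by blast
  then have 1: "c < wrap (Suc p) \<and> wrap (Suc p) < d \<or> wrap (Suc p) + m < d"
    unfolding arc_mem[OF cd p1] .
  have "wrap d \<notin> circle_arc c d"
    unfolding arc_mem[OF cd d1] using cd by (auto simp: wrap_def arc_ends_def)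
  then have "wrap d \<notin> circle_arc p q" using sub by blast
  then have 2: "\<not> (p < wrap d \<and> wrap d < q) \<and> \<not> wrap d + m < q"
    unfolding arc_mem[OF pq d1] by blast
  show "c \<le> p \<and> q \<le> d \<or> q + m \<le> d"
    using 1 2 pq cd unfolding wrap_def arc_ends_def by (simp split: if_splits) linarith+
next
  assume "c \<le> p \<and> q \<le> d \<or> q + m \<le> d"
  then show "circle_arc p q \<subseteq> circle_arc c d"
    using pq cd by (auto simp: circle_arc_def arc_ends_def)
qed

lemma arc_unique:
  assumes "arc_ends p q" "arc_ends c d" "circle_arc p q = circle_arc c d"
  shows "p = c \<and> q = d"
proof -
  have "c \<le> p \<and> q \<le> d \<or> q + m \<le> d" "p \<le> c \<and> d \<le> q \<or> d + m \<le> q"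
    using assms arc_subset_iff by blast+
  then show ?thesis using assms(1,2) m unfolding arc_ends_def by linarith
qed

section \<open>Chords of arcs, the half turn and the degree formula\<close>

definition cycle_chord :: "nat set \<Rightarrow> nat \<times> nat" where
  "cycle_chord T = (SOME (p, q). arc_ends p q \<and> T = circle_arc p q)"

lemma cycle_chord_arc: "arc_ends p q \<Longrightarrow> cycle_chord (circle_arc p q) = (p, q)"
  unfolding cycle_chord_def by (rule some_equality) (use arc_unique in auto)

text \<open>Addition of \<open>m\<close> modulo \<open>2m\<close> at both ends, with the ends put
  back in order.\<close>

definition half_turn :: "nat \<times> nat \<Rightarrow> nat \<times> nat" where
  "half_turn c = (if m \<le> fst c then (fst c - m, snd c - m)
     else if m \<le> snd c then (snd c - m, fst c + m) else (fst c + m, snd c + m))"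

lemma arc_neighbours:
  assumes pq: "arc_ends p q" and v: "v < m" "v \<notin> circle_arc p q"
  shows "(\<exists>u\<in>circle_arc p q. (u, v) \<in> parcs (cycle_graph m)) \<longleftrightarrow> v = p \<or> v = wrap q"
proof
  assume "\<exists>u\<in>circle_arc p q. (u, v) \<in> parcs (cycle_graph m)"
  then obtain u where u: "u \<in> circle_arc p q" "(u, v) \<in> parcs (cycle_graph m)" by blast
  have um: "u < m" using u(1) by (simp add: circle_arc_def)
  have "v = Suc u \<or> u = Suc v \<or> u = 0 \<and> Suc v = m \<or> v = 0 \<and> Suc u = m"
    using u(2) cycle_edge_iff[OF um v(1)] by simp
  then show "v = p \<or> v = wrap q"
    using u(1) v pq unfolding arc_mem[OF pq um] arc_mem[OF pq v(1)] arc_ends_def wrap_def by auto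
next
  have "wrap (Suc p) < m" "wrap (q - 1) < m" using pq m by (auto simp: wrap_def arc_ends_def)
  note mem = arc_mem[OF pq this(1)] arc_mem[OF pq this(2)] and lt = this
  have in_arc: "wrap (Suc p) \<in> circle_arc p q" "wrap (q - 1) \<in> circle_arc p q"
    unfolding mem using pq by (auto simp: wrap_def arc_ends_def)
  assume "v = p \<or> v = wrap q"
  then show "\<exists>u\<in>circle_arc p q. (u, v) \<in> parcs (cycle_graph m)"
  proof
    assume "v = p"
    then have "(wrap (Suc p), v) \<in> parcs (cycle_graph m)"
      unfolding cycle_edge_iff[OF lt(1) v(1)] using v(1) by (auto simp: wrap_def)
    then show ?thesis using in_arc by blast
  next
    assume "v = wrap q"
    then have "(wrap (q - 1), v) \<in> parcs (cycle_graph m)"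
      unfolding cycle_edge_iff[OF lt(2) v(1)] using pq by (auto simp: wrap_def arc_ends_def)
    then show ?thesis using in_arc by blast
  qed
qed

text \<open>The outer neighbours \<open>p\<close> and \<open>wrap q\<close> of the first arc account
  for the two possible crossings of its chord with the orbit of the other. For a diameter the
  neighbours coincide, so one vertex stands for two crossings; hence the factor 2.\<close>

lemma cycle_degree:
  assumes pq: "arc_ends p q" and cd: "arc_ends c d" and ne: "(p, q) \<noteq> (c, d)"
  shows "(if half_turn (p, q) = (p, q) then 2 else 1) *
    real_of_int (compatibility_degree (cycle_graph m) (circle_arc p q) (circle_arc c d)) =
    crossing (p, q) (c, d) + crossing (p, q) (half_turn (c, d))"
proof -
  have ne': "circle_arc p q \<noteq> circle_arc c d" using arc_unique[OF pq cd] ne by blast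
  have ht: "half_turn (p, q) = (p, q) \<longleftrightarrow> q = p + m"
    using pq m by (auto simp: half_turn_def arc_ends_def)
  show ?thesis
  proof (cases "circle_arc p q \<subseteq> circle_arc c d")
    case True
    then have "c \<le> p \<and> q \<le> d \<or> q + m \<le> d" using arc_subset_iff[OF pq cd] by blast
    then have "\<not> crosses (p, q) (c, d)" "\<not> crosses (p, q) (half_turn (c, d))"
      using pq cd by (auto simp: crosses_def half_turn_def arc_ends_def)
    then show ?thesis using True ne' by (simp add: compatibility_degree_def crossing_def)
  next
    case False
    then have nsub: "\<not> (c \<le> p \<and> q \<le> d)" "\<not> q + m \<le> d" using arc_subset_iff[OF pq cd] by blast+
    have lt: "p < m" "wrap q < m" using pq m by (auto simp: wrap_def arc_ends_def)
    have out: "p \<notin> circle_arc p q" "wrap q \<notin> circle_arc p q"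
      unfolding arc_mem[OF pq lt(1)] arc_mem[OF pq lt(2)] using pq by (auto simp: wrap_def arc_ends_def)
    let ?N = "{v \<in> circle_arc c d - circle_arc p q. \<exists>u\<in>circle_arc p q. (u, v) \<in> parcs (cycle_graph m)}"
    have N: "?N = {v \<in> {p, wrap q}. v \<in> circle_arc c d}"
      using arc_neighbours[OF pq] out lt by (auto simp: circle_arc_def)
    have deg: "compatibility_degree (cycle_graph m) (circle_arc p q) (circle_arc c d) = int (card ?N)"
      using False ne' by (simp add: compatibility_degree_def)
    define A where "A \<longleftrightarrow> c < p \<and> p < d \<or> p + m < d"
    define B where "B \<longleftrightarrow> c < wrap q \<and> wrap q < d \<or> wrap q + m < d"
    have AB: "p \<in> circle_arc c d \<longleftrightarrow> A" "wrap q \<in> circle_arc c d \<longleftrightarrow> B"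
      unfolding A_def B_def by (rule arc_mem[OF cd lt(1)], rule arc_mem[OF cd lt(2)])
    define X where "X \<longleftrightarrow> crosses (p, q) (c, d)"
    define Y where "Y \<longleftrightarrow> crosses (p, q) (half_turn (c, d))"
    \<comment> \<open>Only the number of true statements is matched: which neighbour belongs to
      which crossing depends on the position of the arcs.\<close>
    have XY: "A \<and> B \<longleftrightarrow> X \<and> Y" "A \<or> B \<longleftrightarrow> X \<or> Y"
      using nsub pq cd unfolding A_def B_def X_def Y_def wrap_def half_turn_def arc_ends_def crosses_def
      by (cases "q < m"; cases "d < m"; simp; linarith)+
    have sum: "of_bool A + of_bool B = crossing (p, q) (c, d) + crossing (p, q) (half_turn (c, d))"
      using XY unfolding crossing_def X_def[symmetric] Y_def[symmetric] by (auto simp: of_bool_def)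
    show ?thesis
    proof (cases "q = p + m")
      case True
      then have "wrap q = p" using lt by (simp add: wrap_def)
      then have "?N = (if A then {p} else {})" "B = A" using N AB by auto
      then have "real_of_int (compatibility_degree (cycle_graph m) (circle_arc p q) (circle_arc c d)) = of_bool A"
        using deg by simp
      then show ?thesis using True ht sum \<open>B = A\<close> by simp
    next
      case False
      then have "wrap q \<noteq> p" using pq by (auto simp: wrap_def arc_ends_def)
      then have "card ?N = of_bool A + of_bool B"
        unfolding N using AB by (cases A; cases B) (auto simp: Collect_conv_if conj_disj_distribR Collect_disj_eq)
      then show ?thesis using False ht deg sum by simp
    qed
  qed
qed

lemma cycle_properE:
  assumes "proper_tube (cycle_graph m) T"
  obtains p q where "arc_ends p q" "T = circle_arc p q" "cycle_chord T = (p, q)"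
proof -
  obtain p q where "arc_ends p q" "T = circle_arc p q" using assms by (rule cycle_tubeE)
  then show thesis using that cycle_chord_arc by blast
qed

lemma chord_model_cycle: "chord_model (cycle_graph m) (2 * m) half_turn cycle_chord"
proof (intro chord_model.intro chord_model_axioms.intro connected_cycle_graph)
  fix T assume "proper_tube (cycle_graph m) T"
  then obtain p q where "arc_ends p q" "cycle_chord T = (p, q)" by (rule cycle_properE)
  then show "fst (cycle_chord T) < snd (cycle_chord T) \<and> snd (cycle_chord T) < 2 * m"
    by (simp add: arc_ends_def)
next
  fix c :: "nat \<times> nat" assume c: "fst c < snd c \<and> snd c < 2 * m"
  then show "fst (half_turn c) < snd (half_turn c) \<and> snd (half_turn c) < 2 * m"
    by (simp add: half_turn_def) linarith
  show "half_turn (half_turn c) = c"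
    using c by (auto simp: half_turn_def prod_eq_iff)
  show "chord_height (2 * m) (half_turn c) = chord_height (2 * m) c"
    using c by (auto simp: half_turn_def chord_height_def chord_length_def of_nat_diff algebra_simps)
  show "\<not> crosses c (half_turn c)"
    using c by (auto simp: half_turn_def crosses_def)
next
  fix c d :: "nat \<times> nat"
  assume c: "fst c < snd c \<and> snd c < 2 * m" and d: "fst d < snd d \<and> snd d < 2 * m"
  obtain p q where pq: "c = (p, q)" by (cases c)
  obtain r s where rs: "d = (r, s)" by (cases d)
  show "crosses (half_turn c) (half_turn d) \<longleftrightarrow> crosses c d"
    using c d unfolding pq rs half_turn_def crosses_def fst_conv snd_conv
    by (cases "m \<le> p"; cases "m \<le> q"; cases "m \<le> r"; cases "m \<le> s"; simp; linarith)
  assume cd: "crosses c d"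
  \<comment> \<open>A chord that crosses another is no edge of the polygon, so it or its image is
    the selected representative.\<close>
  have "arc_ends p q \<or> arc_ends (fst (half_turn c)) (snd (half_turn c))"
    using c d cd unfolding pq rs half_turn_def arc_ends_def crosses_def fst_conv snd_conv
    by (cases "m \<le> p"; cases "m \<le> q"; simp; linarith)
  then show "\<exists>T. proper_tube (cycle_graph m) T \<and> (cycle_chord T = c \<or> cycle_chord T = half_turn c)"
    using arc_proper cycle_chord_arc pq by (metis prod.collapse)
next
  fix T U assume T: "proper_tube (cycle_graph m) T" and U: "proper_tube (cycle_graph m) U"
  obtain p q where pq: "arc_ends p q" "T = circle_arc p q" "cycle_chord T = (p, q)"
    using T by (rule cycle_properE)
  obtain c d where cd: "arc_ends c d" "U = circle_arc c d" "cycle_chord U = (c, d)"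
    using U by (rule cycle_properE)
  show "T = U" if "cycle_chord T = cycle_chord U \<or> cycle_chord T = half_turn (cycle_chord U)"
  proof -
    have "(p, q) = (c, d)"
      using that pq cd by (auto simp: half_turn_def arc_ends_def split: if_splits)
    then show ?thesis using pq cd by simp
  qed
  assume "T \<noteq> U"
  then show "(if half_turn (cycle_chord T) = cycle_chord T then 2 else 1) *
      real_of_int (compatibility_degree (cycle_graph m) T U) =
      crossing (cycle_chord T) (cycle_chord U) + crossing (cycle_chord T) (half_turn (cycle_chord U))"
    using cycle_degree[OF pq(1) cd(1)] unfolding pq(3) cd(3) unfolding pq(2) cd(2) by blast
qed

end

theorem theorem5p17:
  fixes n :: nat
    and G :: "nat pair_pre_digraph"
    and T0 :: "'i::finite \<Rightarrow> nat set"
  assumes "(n \<ge> 1 \<and> G = path_graph (n + 1)) \<or> (n \<ge> 2 \<and> G = cycle_graph (n + 1))"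
    and "inj T0"
    and "maximal_tubing G (range T0)"
  shows "polytopal (compatibility_fan G T0) \<and> polytopal (dual_compatibility_fan G T0)"
proof -
  have "\<exists>N rot chord. chord_model G N rot chord"
    using assms(1) chord_model_path[of "n + 1"] chord_model_cycle[of "n + 1"] by auto
  then obtain N rot chord where "chord_model G N rot chord" by blast
  then interpret initial_tubing G N rot chord "\<lambda>c. fst c < snd c \<and> snd c < N" T0
    using assms(2,3) by (intro initial_tubing.intro initial_tubing_axioms.intro)
  show ?thesis using polytopal_compatibility_fans by blast
qed

end
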